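(* Let $q\geq2$ and $a\geq1$ be fixed integers, and let $H$ be the complete $q$-partite graph whose $q$ vertex classes $V_1,\ldots,V_q$ each have size $a$. Replace every vertex of $H$ by an independent set of size $M$. If $N=aqM$ and $L_q=\log\frac{q}{q-1}$, then, as $M\to\infty$, $$\mathrm{AO}(H[\underbrace{M,\ldots,M}_{aq}])\sim\frac{N!}{(q-1)(1-L_q)^{(q-1)/2}q^NL_q^{N+1}}.$$ More generally, if the vertices of $H$ are replaced by independent sets of sizes $\lambda_i$ with total $N=\sum_i\lambda_i\to\infty$, and the total size $\sum_{i\in V_j}\lambda_i$ of the blown-up sets over each vertex class $V_j$ of $H$ is $N/q+O(1)$, then the same asymptotic holds for $\mathrm{AO}(H[\lambda])$.
   Context: $\mathrm{AO}(G)$ is the number of acyclic orientations of $G$. For a graph $H$ and sizes $\lambda=(\lambda_i)_{i\in V(H)}$, $H[\lambda]$ is the graph obtained from $H$ by replacing each vertex $i$ with an independent set of size $\lambda_i$ and each edge $ij$ with all edges between the corresponding sets. $a_N\sim b_N$ means $a_N/b_N\to1$. *)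

theory Defs
  imports Complex_Main "HOL-Library.Landau_Symbols" "HOL-Library.Disjoint_Sets"
begin

text \<open>A simple graph is given by its vertex set and its set of edges, an edge being the
  two-element set of its end points.\<close>

type_synonym 'v sgraph = "'v set \<times> 'v set set"

definition verts :: "'v sgraph \<Rightarrow> 'v set" where
  "verts G = fst G"

definition edges :: "'v sgraph \<Rightarrow> 'v set set" where
  "edges G = snd G"

text \<open>An orientation is identified with its set of arcs: it contains exactly one of
  \<open>(u, v)\<close>, \<open>(v, u)\<close> for every edge \<open>{u, v}\<close>, and nothing else.\<close>

definition orientation :: "'v sgraph \<Rightarrow> ('v \<times> 'v) set \<Rightarrow> bool" where
  "orientation G D \<longleftrightarrow>
     (\<forall>u v. (u, v) \<in> D \<longrightarrow> {u, v} \<in> edges G) \<and>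
     (\<forall>u v. {u, v} \<in> edges G \<longrightarrow> ((u, v) \<in> D) \<noteq> ((v, u) \<in> D))"

definition AO :: "'v sgraph \<Rightarrow> nat" where
  "AO G = card {D. orientation G D \<and> acyclic D}"

definition complete_multipartite :: "nat \<Rightarrow> (nat \<Rightarrow> 'v set) \<Rightarrow> 'v sgraph" where
  "complete_multipartite q V =
     (\<Union>j\<in>{1..q}. V j,
      {{u, v} | u v. \<exists>i\<in>{1..q}. \<exists>j\<in>{1..q}. i \<noteq> j \<and> u \<in> V i \<and> v \<in> V j})"

text \<open>The vertex \<open>i\<close> of \<open>H\<close> is replaced by the independent set
  \<open>{(i, k) | k. k < sz i}\<close>; the size \<open>sz i\<close> is allowed to be zero.\<close>

definition blowup :: "'v sgraph \<Rightarrow> ('v \<Rightarrow> nat) \<Rightarrow> ('v \<times> nat) sgraph" where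
  "blowup H sz =
     ({(i, k). i \<in> verts H \<and> k < sz i},
      {{(i, k), (j, l)} | i j k l. {i, j} \<in> edges H \<and> k < sz i \<and> l < sz j})"

definition Lq :: "nat \<Rightarrow> real" where
  "Lq q = ln (real q / (real q - 1))"

definition AO_main_term :: "nat \<Rightarrow> nat \<Rightarrow> real" where
  "AO_main_term q N =
     fact N / ((real q - 1) * (1 - Lq q) powr ((real q - 1) / 2) * real q ^ N * Lq q ^ (N + 1))"

end

theory Submission
  imports Defs "HOL-Probability.Probability" "HOL-Complex_Analysis.Complex_Analysis"
begin

text \<open>The sources of an acyclic orientation of a nonempty graph form a nonempty independent set.
  Inclusion-exclusion over the subsets of that set gives a recurrence for the number of acyclic orientations of a complete
  multipartite graph with part sizes \<open>n\<^sub>1, \<dots>, n\<^sub>q\<close>; it is the recurrence satisfied by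
  \<open>\<integral>\<^sub>0\<^sup>\<infinity> exp (-t) P\<^sub>1(t) \<cdots> P\<^sub>q(t) dt\<close>, where \<open>P\<^sub>j(t)\<close> is \<open>n\<^sub>j!\<close> times the coefficient
  of \<open>x ^ n\<^sub>j\<close> in \<open>exp (t (1 - exp (-x)))\<close>. Cauchy's formula on the circle of radius
  \<open>L = ln (q / (q - 1))\<close> turns \<open>exp (-t / q) P\<^sub>j(t)\<close> into a Fourier integral which behaves like a local
  limit theorem: it has height of order \<open>1 / sqrt t\<close>, Gaussian shape, and is concentrated at
  \<open>t\<close> close to \<open>n\<^sub>j / (L exp (-L))\<close>. For part sizes \<open>N / q + O(1)\<close> all factors peak at the same
  \<open>t\<close>, so dominated convergence on the scale \<open>sqrt N\<close> yields the integral. The same local limit theorem for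
  the Poisson weights \<open>exp (-t) t ^ n / n!\<close> replaces Stirling's formula.\<close>

section \<open>Acyclic orientations of complete multipartite graphs\<close>

text \<open>The weight dictates the radius: \<open>1 - exp (-L) = 1/q\<close> holds exactly for
  \<open>L = ln (q/(q-1))\<close>, so the \<open>q\<close> exponential prefactors multiply to
  \<open>exp t\<close> and cancel \<open>exp (-t)\<close>. Only normalised densities remain under
  the integral. They need not be probabilities, because \<open>1 - exp (-x)\<close> has alternating
  coefficients. The local limit theorem therefore rests on the Fourier side alone: the real part of
  the exponent is negative away from 0 (here \<open>L < 1\<close> enters), and an integration by
  parts controls the tail in \<open>t\<close>. Constants: per unit of \<open>t\<close> the exponent
  has mean \<open>\<mu> = L exp (-L)\<close> and variance \<open>\<mu> (1 - L)\<close>, whereas the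
  Poisson weights behind the factorials have variance equal to the mean. Relative to them,
  \<open>q\<close> Gaussian heights contribute \<open>(1 - L) powr (-q/2)\<close> and the width of
  their product gives back \<open>(1 - L) powr (1/2)\<close>; this is the exponent
  \<open>(q - 1)/2\<close>. The remaining factor \<open>(q - 1) L\<close> is \<open>q \<mu>\<close>,
  since integrating over \<open>t\<close> costs \<open>1/(q \<mu>)\<close>.\<close>

definition sources :: "'v set \<Rightarrow> ('v \<times> 'v) set \<Rightarrow> 'v set" where
  "sources X D = {v \<in> X. \<forall>u. (u, v) \<notin> D}"

abbreviation acyclic_orientations :: "'v sgraph \<Rightarrow> ('v \<times> 'v) set set" where
  "acyclic_orientations G \<equiv> {D. orientation G D \<and> acyclic D}"

lemma AO_cong_edges: "edges G = edges G' \<Longrightarrow> AO G = AO G'"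
  by (simp add: AO_def orientation_def)

lemma edge_complete_multipartite_iff:
  "{u, v} \<in> edges (complete_multipartite q W) \<longleftrightarrow>
     (\<exists>i\<in>{1..q}. \<exists>j\<in>{1..q}. i \<noteq> j \<and> u \<in> W i \<and> v \<in> W j)"
    (is "?L \<longleftrightarrow> ?R")
proof
  assume ?L
  then obtain u' v' i j where *: "{u, v} = {u', v'}" "i \<in> {1..q}" "j \<in> {1..q}" "i \<noteq> j"
    "u' \<in> W i" "v' \<in> W j"
    unfolding complete_multipartite_def edges_def snd_conv mem_Collect_eq
    by (elim exE conjE bexE) (rule that)
  from *(1) consider "u = u'" "v = v'" | "u = v'" "v = u'" by (auto simp: doubleton_eq_iff)
  then show ?R
  proof cases
    case 1
    then show ?thesis using * by (intro bexI[of _ i] bexI[of _ j]) auto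
  next
    case 2
    then show ?thesis using * by (intro bexI[of _ j] bexI[of _ i]) auto
  qed
next
  assume ?R
  then show ?L unfolding complete_multipartite_def edges_def snd_conv mem_Collect_eq
    by (intro exI[of _ u] exI[of _ v] conjI refl)
qed

lemma orientation_arc: "orientation G D \<Longrightarrow> (u, v) \<in> D \<Longrightarrow> {u, v} \<in> edges G"
  by (simp add: orientation_def)

lemma orientation_edge:
  "orientation G D \<Longrightarrow> {u, v} \<in> edges G \<Longrightarrow> (u, v) \<in> D \<longleftrightarrow> (v, u) \<notin> D"
  unfolding orientation_def by blast

text \<open>Copies are adjacent exactly when their classes differ, so a blow-up is again complete
  multipartite and only the total size over each class matters. Edge sets suffice, since
  \<open>AO\<close> does not look at the vertex set.\<close>

lemma edges_blowup_complete_multipartite: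
  "edges (blowup (complete_multipartite q V) sz) =
   edges (complete_multipartite q (\<lambda>j. SIGMA i:V j. {..<sz i}))"
proof -
  let ?B = "edges (blowup (complete_multipartite q V) sz)"
  let ?C = "edges (complete_multipartite q (\<lambda>j. SIGMA i:V j. {..<sz i}))"
  have B: "?B = {{(i, k), (j, l)} | i j k l. (\<exists>i'\<in>{1..q}. \<exists>j'\<in>{1..q}. i' \<noteq> j' \<and> i \<in> V i' \<and> j \<in> V j')
        \<and> k < sz i \<and> l < sz j}"
    unfolding blowup_def edges_def snd_conv
    using edge_complete_multipartite_iff[of _ _ q V, unfolded edges_def] by simp
  show ?thesis
  proof (intro equalityI subsetI)
    fix e assume "e \<in> ?B"
    then obtain i j k l i' j' where e: "e = {(i, k), (j, l)}" "k < sz i" "l < sz j"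
      "i' \<in> {1..q}" "j' \<in> {1..q}" "i' \<noteq> j'" "i \<in> V i'" "j \<in> V j'" unfolding B by blast
    show "e \<in> ?C" unfolding e(1) edge_complete_multipartite_iff
      by (intro bexI[of _ i'] bexI[of _ j']) (use e in auto)
  next
    fix e assume "e \<in> ?C"
    then have "\<exists>u v. e = {u, v} \<and> (\<exists>i\<in>{1..q}. \<exists>j\<in>{1..q}. i \<noteq> j \<and>
        u \<in> (SIGMA i:V i. {..<sz i}) \<and> v \<in> (SIGMA i:V j. {..<sz i}))"
      unfolding complete_multipartite_def edges_def snd_conv mem_Collect_eq .
    then obtain u v i' j' where "e = {u, v}" "i' \<in> {1..q}" "j' \<in> {1..q}" "i' \<noteq> j'"
      "u \<in> (SIGMA i:V i'. {..<sz i})" "v \<in> (SIGMA i:V j'. {..<sz i})"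
      by (elim exE conjE bexE) (rule that)
    moreover obtain i k where "u = (i, k)" by (cases u)
    moreover obtain j l where "v = (j, l)" by (cases v)
    ultimately have e: "e = {(i, k), (j, l)}" "k < sz i" "l < sz j"
      "i' \<in> {1..q}" "j' \<in> {1..q}" "i' \<noteq> j'" "i \<in> V i'" "j \<in> V j'"
      by simp_all
    show "e \<in> ?B" unfolding B mem_Collect_eq
      by (rule exI[of _ i], rule exI[of _ j], rule exI[of _ k], rule exI[of _ l],
          intro conjI bexI[of _ i'] bexI[of _ j'] e)
  qed
qed

section \<open>Inclusion-exclusion over sets of sources\<close>

lemma sum_alternating_nonempty_subsets:
  assumes "finite X" "X \<noteq> {}"
  shows "(\<Sum>S\<in>Pow X - {{}}. (-1) ^ (card S + 1)) = (1 :: int)"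
proof -
  have "(\<Sum>S\<in>Pow X. (-1) ^ (card S + 1)) = - (\<Sum>S\<in>Pow X. (-1 :: int) ^ card S)"
    by (simp add: sum_negf)
  also have "(\<Sum>S\<in>Pow X. (-1 :: int) ^ card S) = 0"
  proof -
    \<comment> \<open>Pairing \<open>S\<close> with \<open>insert x S\<close> flips the sign, so the
      sum over all subsets cancels; removing the empty set, which contributes -1, leaves 1.\<close>
    obtain x where x: "x \<in> X" using assms by auto
    have "Pow X = Pow (X - {x}) \<union> insert x ` Pow (X - {x})"
      using Pow_insert[of x "X - {x}"] x by (simp add: insert_absorb)
    moreover have "Pow (X - {x}) \<inter> insert x ` Pow (X - {x}) = {}" by auto
    moreover have "inj_on (insert x) (Pow (X - {x}))" by (auto simp: inj_on_def)
    moreover have "card (insert x S) = Suc (card S)" if "S \<in> Pow (X - {x})" for S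
      using that assms finite_subset[of S X] by (subst card_insert_disjoint) auto
    ultimately show ?thesis using assms
      by (simp add: sum.union_disjoint sum.reindex sum_negf)
  qed
  finally have "(\<Sum>S\<in>Pow X. (-1) ^ (card S + 1)) = (0 :: int)" by simp
  moreover have "(\<Sum>S\<in>Pow X. (-1) ^ (card S + 1)) = 
     (-1) ^ (card {} + 1) + (\<Sum>S\<in>Pow X - {{}}. (-1) ^ (card S + 1) :: int)"
    using assms by (subst sum.remove[of "Pow X" "{}"]) auto
  ultimately show ?thesis by simp
qed

lemma sources_nonempty:
  assumes "finite X" "X \<noteq> {}" "D \<subseteq> X \<times> X" "acyclic D"
  shows "sources X D \<noteq> {}"
proof -
  have "wf D" using assms finite_subset finite_acyclic_wf by blast
  then obtain z where "z \<in> X" "\<And>y. (y, z) \<in> D \<Longrightarrow> y \<notin> X"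
    using assms(2) by (metis all_not_in_conv wfE_min)
  then show ?thesis using assms(3) by (auto simp: sources_def)
qed

text \<open>No arc enters \<open>S\<close>, so a path starting outside \<open>S\<close> never visits
  \<open>S\<close> and uses arcs of \<open>D\<close> only. The base point of a cycle is the head of
  an arc, hence outside \<open>S\<close>.\<close>

lemma acyclic_add_sources:
  assumes "acyclic D" "Range D \<inter> S = {}" "R \<inter> S = {}"
  shows "acyclic (D \<union> S \<times> R)"
proof -
  have *: "(x, y) \<in> D\<^sup>+ \<and> y \<notin> S" if "(x, y) \<in> (D \<union> S \<times> R)\<^sup>+" "x \<notin> S" for x y
    using that(1)
  proof (induction rule: trancl_induct)
    case (base y)
    then show ?case using that(2) assms by auto
  next
    case (step y z)
    then show ?case using assms(2) by (auto intro: trancl_into_trancl)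
  qed
  show ?thesis unfolding acyclic_def
  proof (intro allI notI)
    fix x assume x: "(x, x) \<in> (D \<union> S \<times> R)\<^sup>+"
    have "x \<in> Range (D \<union> S \<times> R)" using x by (metis RangeI trancl_range)
    then have "x \<notin> S" using assms by auto
    then show False using * x assms(1) by (auto simp: acyclic_def)
  qed
qed

context
  fixes q :: nat and W :: "nat \<Rightarrow> 'v set"
  assumes disj: "disjoint_family_on W {1..q}"
begin

lemma same_part: "i = j" if "x \<in> W i" "x \<in> W j" "i \<in> {1..q}" "j \<in> {1..q}"
  using disj that by (metis disjoint_iff disjoint_family_on_def)

text \<open>The arcs at a source are forced, and arcs into \<open>S\<close> do not exist, so deleting \<open>S\<close> loses nothing.\<close>

lemma card_acyclic_orientations_sources:
  assumes j: "j \<in> {1..q}" and S: "S \<subseteq> W j"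
  shows "card {D \<in> acyclic_orientations (complete_multipartite q W).
           S \<subseteq> sources (\<Union>i\<in>{1..q}. W i) D} =
         AO (complete_multipartite q (W(j := W j - S)))"
proof -
  define R where "R = (\<Union>i\<in>{1..q} - {j}. W i)"
  define W' where "W' = W(j := W j - S)"
  \<comment> \<open>In an orientation whose sources include \<open>S\<close>, the arcs leaving
    \<open>S\<close> are exactly \<open>S \<times> R\<close>. Hence restoring them
    (\<open>f\<close>) and deleting them (\<open>g\<close>) are mutually inverse.\<close>
  define f where "f = (\<lambda>D. D \<union> S \<times> R)"
  define g where "g = (\<lambda>D :: ('v \<times> 'v) set. D - S \<times> UNIV)"
  have Wj: "i = j" if "x \<in> W i" "i \<in> {1..q}" "x \<in> S" for x i
    using same_part[OF that(1) _ that(2) j] S that(3) by blast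
  have disjR: "R \<inter> S = {}" using Wj by (force simp: R_def)
  have W': "x \<in> W' i \<longleftrightarrow> x \<in> W i \<and> x \<notin> S" if "i \<in> {1..q}" for x i
    using Wj[of x i] that by (auto simp: W'_def)
  have e': "{u, v} \<in> edges (complete_multipartite q W') \<longleftrightarrow>
     {u, v} \<in> edges (complete_multipartite q W) \<and> u \<notin> S \<and> v \<notin> S" for u v
    unfolding edge_complete_multipartite_iff using W' by metis
  have eS: "{s, v} \<in> edges (complete_multipartite q W) \<longleftrightarrow> v \<in> R" if s: "s \<in> S" for s v
  proof
    assume "{s, v} \<in> edges (complete_multipartite q W)"
    then obtain i k where "i \<in> {1..q}" "k \<in> {1..q}" "i \<noteq> k" "s \<in> W i" "v \<in> W k"
      unfolding edge_complete_multipartite_iff by blast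
    then show "v \<in> R" using Wj[of s i] s unfolding R_def by blast
  next
    assume "v \<in> R"
    then obtain k where k: "k \<in> {1..q}" "k \<noteq> j" "v \<in> W k" unfolding R_def by blast
    show "{s, v} \<in> edges (complete_multipartite q W)"
      unfolding edge_complete_multipartite_iff
      by (intro bexI[of _ j] bexI[of _ k]) (use k j S s in auto)
  qed
  define A where "A = acyclic_orientations (complete_multipartite q W)"
  define A' where "A' = acyclic_orientations (complete_multipartite q W')"
  define B where "B = {D \<in> A. S \<subseteq> sources (\<Union>i\<in>{1..q}. W i) D}"
  have noS: "x \<notin> S" "y \<notin> S" if D: "D \<in> A'" and xy: "(x, y) \<in> D" for D x y
  proof -
    have "orientation (complete_multipartite q W') D" using D by (simp add: A'_def)
    then have "{x, y} \<in> edges (complete_multipartite q W')" using xy by (rule orientation_arc)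
    then show "x \<notin> S" "y \<notin> S" unfolding e' by simp_all
  qed
  have noB: "(u, s) \<notin> D" if "D \<in> B" "s \<in> S" for D u s
    using that unfolding B_def sources_def by blast
  have "bij_betw f A' B"
  proof (rule bij_betw_byWitness[where f' = g])
    show "\<forall>D\<in>A'. g (f D) = D"
      using noS unfolding f_def g_def by blast
    show "\<forall>D\<in>B. f (g D) = D"
    proof
      fix D assume D: "D \<in> B"
      have o: "orientation (complete_multipartite q W) D" using D by (simp add: B_def A_def)
      have "D \<inter> S \<times> UNIV = S \<times> R"
      proof (intro equalityI subrelI)
        fix s v assume "(s, v) \<in> D \<inter> S \<times> UNIV"
        then show "(s, v) \<in> S \<times> R" using orientation_arc[OF o] eS by blast
      next
        fix s v assume "(s, v) \<in> S \<times> R"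
        then show "(s, v) \<in> D \<inter> S \<times> UNIV"
          using orientation_edge[OF o, of s v] eS[of s v] noB[OF D, of s v] by blast
      qed
      then show "f (g D) = D" by (auto simp: f_def g_def)
    qed
    show "f ` A' \<subseteq> B"
    proof (rule image_subsetI)
      fix D assume D: "D \<in> A'"
      have o: "orientation (complete_multipartite q W') D" and ac: "acyclic D"
        using D by (simp_all add: A'_def)
      have "acyclic (f D)" unfolding f_def
        by (rule acyclic_add_sources[OF ac _ disjR]) (use noS[OF D] in blast)
      moreover have "orientation (complete_multipartite q W) (f D)"
        unfolding orientation_def
      proof (intro conjI allI impI)
        fix x y assume "(x, y) \<in> f D"
        then show "{x, y} \<in> edges (complete_multipartite q W)"
          using orientation_arc[OF o] e' eS unfolding f_def by blast
      next
        fix x y assume xy: "{x, y} \<in> edges (complete_multipartite q W)"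
        have yx: "{y, x} \<in> edges (complete_multipartite q W)"
          using xy by (simp add: insert_commute)
        consider "x \<in> S" | "y \<in> S" | "x \<notin> S" "y \<notin> S" by blast
        then show "((x, y) \<in> f D) \<noteq> ((y, x) \<in> f D)"
        proof cases
          case 1
          then have "y \<in> R" using xy eS by simp
          then show ?thesis using 1 disjR noS[OF D] unfolding f_def by blast
        next
          case 2
          then have "x \<in> R" using yx eS by simp
          then show ?thesis using 2 disjR noS[OF D] unfolding f_def by blast
        next
          case 3
          then have "{x, y} \<in> edges (complete_multipartite q W')" using xy e' by simp
          then show ?thesis using orientation_edge[OF o, of x y] 3 unfolding f_def by blast
        qed
      qed
      moreover have "S \<subseteq> sources (\<Union>i\<in>{1..q}. W i) (f D)"
      proof
        fix s assume s: "s \<in> S"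
        then have "s \<in> (\<Union>i\<in>{1..q}. W i)" using S by (intro UN_I[OF j]) auto
        moreover have "(u, s) \<notin> f D" for u using s noS(2)[OF D] disjR by (auto simp: f_def)
        ultimately show "s \<in> sources (\<Union>i\<in>{1..q}. W i) (f D)" by (simp add: sources_def)
      qed
      ultimately show "f D \<in> B" by (simp add: B_def A_def)
    qed
    show "g ` B \<subseteq> A'"
    proof (rule image_subsetI)
      fix D assume D: "D \<in> B"
      have o: "orientation (complete_multipartite q W) D" and ac: "acyclic D"
        using D by (simp_all add: B_def A_def)
      have "acyclic (g D)" by (rule acyclic_subset[OF ac]) (auto simp: g_def)
      moreover have "orientation (complete_multipartite q W') (g D)"
        unfolding orientation_def
      proof (intro conjI allI impI)
        fix x y assume "(x, y) \<in> g D"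
        then show "{x, y} \<in> edges (complete_multipartite q W')"
          using e' orientation_arc[OF o, of x y] noB[OF D] unfolding g_def by blast
      next
        fix x y assume "{x, y} \<in> edges (complete_multipartite q W')"
        then show "((x, y) \<in> g D) \<noteq> ((y, x) \<in> g D)"
          using e' orientation_edge[OF o, of x y] unfolding g_def by blast
      qed
      ultimately show "g D \<in> A'" by (simp add: A'_def)
    qed
  qed
  then show ?thesis using bij_betw_same_card[of f A' B]
    unfolding AO_def W'_def[symmetric] by (simp add: A'_def B_def A_def)
qed

lemma AO_complete_multipartite_rec:
  assumes fin: "\<And>j. j \<in> {1..q} \<Longrightarrow> finite (W j)" and ne: "(\<Union>j\<in>{1..q}. W j) \<noteq> {}"
  shows "int (AO (complete_multipartite q W)) =
    (\<Sum>j\<in>{1..q}. \<Sum>S\<in>Pow (W j) - {{}}.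
       (-1) ^ (card S + 1) * int (AO (complete_multipartite q (W(j := W j - S)))))"
proof -
  define G where "G = complete_multipartite q W"
  define X where "X = (\<Union>j\<in>{1..q}. W j)"
  define A where "A = acyclic_orientations G"
  have finX: "finite X" using fin by (auto simp: X_def)
  have sub: "D \<subseteq> X \<times> X" if "D \<in> A" for D
  proof (rule subrelI)
    fix u v assume uv: "(u, v) \<in> D"
    have "orientation G D" using that by (simp add: A_def)
    then have "{u, v} \<in> edges G" using uv by (rule orientation_arc)
    then obtain i k where "i \<in> {1..q}" "k \<in> {1..q}" "u \<in> W i" "v \<in> W k"
      unfolding G_def edge_complete_multipartite_iff by metis
    then show "(u, v) \<in> X \<times> X" unfolding X_def by (intro SigmaI UN_I)
  qed
  have finA: "finite A" by (rule finite_subset[of _ "Pow (X \<times> X)"]) (use sub finX in auto)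
  have "int (AO G) = (\<Sum>D\<in>A. 1)" by (simp add: AO_def A_def)
  also have "\<dots> = (\<Sum>D\<in>A. \<Sum>S\<in>Pow (sources X D) - {{}}. (-1) ^ (card S + 1))"
  proof (intro sum.cong refl)
    fix D assume D: "D \<in> A"
    have "sources X D \<noteq> {}"
      by (rule sources_nonempty) (use finX ne sub D in \<open>auto simp: X_def A_def\<close>)
    moreover have "finite (sources X D)" using finX by (auto simp: sources_def)
    ultimately show "1 = (\<Sum>S\<in>Pow (sources X D) - {{}}. (-1 :: int) ^ (card S + 1))"
      using sum_alternating_nonempty_subsets by metis
  qed
  also have "\<dots> = (\<Sum>D\<in>A. \<Sum>S\<in>Pow X - {{}}. if S \<subseteq> sources X D then (-1) ^ (card S + 1) else 0)"
    by (intro sum.cong refl sum.mono_neutral_cong_left) (use finX in \<open>auto simp: sources_def\<close>)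
  also have "\<dots> = (\<Sum>S\<in>Pow X - {{}}. (-1) ^ (card S + 1) * int (card {D \<in> A. S \<subseteq> sources X D}))"
    using finA by (subst sum.swap) (simp add: sum.If_cases Int_def mult.commute)
  \<comment> \<open>Two vertices in different parts are joined by an edge, so they cannot both be
    sources: only sets inside a single part contribute.\<close>
  also have "\<dots> = (\<Sum>S\<in>(\<Union>j\<in>{1..q}. Pow (W j) - {{}}).
      (-1) ^ (card S + 1) * int (card {D \<in> A. S \<subseteq> sources X D}))"
  proof (intro sum.mono_neutral_right ballI)
    fix S assume S: "S \<in> Pow X - {{}} - (\<Union>j\<in>{1..q}. Pow (W j) - {{}})"
    then obtain u where u: "u \<in> S" "u \<in> X" by blast
    then obtain i where i: "i \<in> {1..q}" "u \<in> W i" by (auto simp: X_def)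
    have "\<not> S \<subseteq> W i" using S i by blast
    then obtain v where v: "v \<in> S" "v \<notin> W i" by blast
    then have "v \<in> X" using S by blast
    then obtain k where k: "k \<in> {1..q}" "v \<in> W k" by (auto simp: X_def)
    have "i \<noteq> k" using k(2) v(2) by blast
    then have uv: "{u, v} \<in> edges G" unfolding G_def edge_complete_multipartite_iff
      using i k by (intro bexI[of _ i] bexI[of _ k] conjI) auto
    have "\<not> S \<subseteq> sources X D" if "D \<in> A" for D
    proof -
      have "orientation G D" using that by (simp add: A_def)
      from orientation_edge[OF this uv] show ?thesis using u(1) v(1) by (auto simp: sources_def)
    qed
    then have "{D \<in> A. S \<subseteq> sources X D} = {}" by blast
    then show "(-1) ^ (card S + 1) * int (card {D \<in> A. S \<subseteq> sources X D}) = 0"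
      by (simp only: card.empty of_nat_0 mult_zero_right)
  next
    show "(\<Union>j\<in>{1..q}. Pow (W j) - {{}}) \<subseteq> Pow X - {{}}"
      by (intro UN_least Diff_mono Pow_mono) (auto simp: X_def)
  qed (use finX in auto)
  also have "\<dots> = (\<Sum>j\<in>{1..q}. \<Sum>S\<in>Pow (W j) - {{}}.
      (-1) ^ (card S + 1) * int (card {D \<in> A. S \<subseteq> sources X D}))"
  \<comment> \<open>The empty set is the only common subset of two different parts, and it has been
    removed.\<close>
  proof (intro sum.UNION_disjoint ballI impI)
    fix i k assume ik: "i \<in> {1..q}" "k \<in> {1..q}" "i \<noteq> k"
    then have "W i \<inter> W k = {}" using disj by (auto simp: disjoint_family_on_def)
    then show "(Pow (W i) - {{}}) \<inter> (Pow (W k) - {{}}) = {}" by blast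
  qed (use fin in auto)
  also have "\<dots> = (\<Sum>j\<in>{1..q}. \<Sum>S\<in>Pow (W j) - {{}}.
       (-1) ^ (card S + 1) * int (AO (complete_multipartite q (W(j := W j - S)))))"
    using card_acyclic_orientations_sources unfolding A_def G_def X_def
    by (intro sum.cong refl) auto
  finally show ?thesis unfolding G_def .
qed

end

lemma AO_complete_multipartite_empty:
  assumes "(\<Union>j\<in>{1..q}. W j) = {}"
  shows "AO (complete_multipartite q W) = 1"
proof -
  have "acyclic_orientations (complete_multipartite q W) = {{}}"
    using assms by (auto simp: orientation_def edge_complete_multipartite_iff acyclic_def)
  then show ?thesis by (simp add: AO_def)
qed

section \<open>The integral representation\<close>

text \<open>The exponential generating function of the inclusion-exclusion signs
  \<open>(-1) ^ (k + 1)\<close> for \<open>k \<ge> 1\<close>.\<close>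

definition part_fps :: "complex fps" where "part_fps = 1 - fps_exp (- 1)"

text \<open>The exponential coefficient of \<open>x ^ n\<close> in \<open>exp (t (1 - exp (-x)))\<close>, as a polynomial in \<open>t\<close>.\<close>

definition part_poly :: "nat \<Rightarrow> complex poly" where
  "part_poly n = smult (fact n) (\<Sum>m\<le>n. monom (fps_nth (part_fps ^ m) n / fact m) m)"

lemma part_fps_nth: "fps_nth part_fps k = (if k = 0 then 0 else (- 1) ^ (k + 1) / fact k)"
  by (simp add: part_fps_def)

lemma coeff_part_poly: "coeff (part_poly n) m = fact n * fps_nth (part_fps ^ m) n / fact m"
proof -
  \<comment> \<open>\<open>part_fps\<close> has zero constant term, so stopping at
    \<open>m \<le> n\<close> in \<open>part_poly\<close> loses nothing.\<close>
  have "fps_nth (part_fps ^ m) n = 0" if "n < m"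
    using startsby_zero_power_prefix[of part_fps m] that by (simp add: part_fps_nth)
  then show ?thesis by (auto simp: part_poly_def coeff_sum)
qed

lemma poly_part_poly: "poly (part_poly n) t = fact n * fps_nth (fps_exp t oo part_fps) n"
  by (auto simp: part_poly_def fps_compose_nth poly_sum poly_monom atLeast0AtMost
      sum_distrib_left intro!: sum.cong)

lemma part_poly_0 [simp]: "part_poly 0 = 1"
  by (simp add: part_poly_def monom_0 one_pCons)

lemma poly_part_poly_0: "n > 0 \<Longrightarrow> poly (part_poly n) 0 = 0"
  by (simp add: poly_0_coeff_0 coeff_part_poly)

text \<open>Differentiating \<open>exp (t f(x))\<close> in \<open>t\<close> multiplies it by
  \<open>f(x)\<close>; with \<open>f = part_fps\<close>, this is the resulting binomial convolution
  of exponential coefficients of \<open>x ^ n\<close>.\<close>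

lemma pderiv_part_poly:
  "pderiv (part_poly n) = (\<Sum>k=1..n. smult ((- 1) ^ (k + 1) * of_nat (n choose k)) (part_poly (n - k)))"
proof (rule poly_eqI)
  fix m
  have *: "fact n * fps_nth part_fps k = (- 1) ^ (k + 1) * of_nat (n choose k) * fact (n - k)"
    if "k \<in> {1..n}" for k
    using that by (simp add: part_fps_nth binomial_fact field_simps)
  have "coeff (pderiv (part_poly n)) m = fact n * fps_nth (part_fps ^ Suc m) n / fact m"
    by (simp add: coeff_pderiv coeff_part_poly fact_Suc del: power_Suc of_nat_Suc)
  also have "fps_nth (part_fps ^ Suc m) n = (\<Sum>k=0..n. fps_nth part_fps k * fps_nth (part_fps ^ m) (n - k))"
    by (simp add: fps_mult_nth)
  also have "\<dots> = (\<Sum>k=1..n. fps_nth part_fps k * fps_nth (part_fps ^ m) (n - k))"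
    by (intro sum.mono_neutral_right) (auto simp: part_fps_nth not_less_eq_eq)
  also have "fact n * \<dots> / fact m =
      (\<Sum>k=1..n. (fact n * fps_nth part_fps k) * fps_nth (part_fps ^ m) (n - k) / fact m)"
    by (simp add: sum_distrib_left sum_divide_distrib mult.assoc)
  also have "\<dots> = (\<Sum>k=1..n. (- 1) ^ (k + 1) * of_nat (n choose k) * coeff (part_poly (n - k)) m)"
    by (intro sum.cong refl) (simp only: *, simp add: coeff_part_poly)
  finally show "coeff (pderiv (part_poly n)) m =
    coeff (\<Sum>k=1..n. smult ((- 1) ^ (k + 1) * of_nat (n choose k)) (part_poly (n - k))) m"
    by (simp add: coeff_sum)
qed

lemma sum_nonempty_subsets_card:
  fixes g :: "nat \<Rightarrow> 'b :: comm_semiring_1"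
  assumes "finite X"
  shows "(\<Sum>S\<in>Pow X - {{}}. g (card S)) = (\<Sum>k=1..card X. of_nat (card X choose k) * g k)"
proof -
  have "(\<Sum>S\<in>Pow X - {{}}. g (card S)) =
      (\<Sum>k=1..card X. \<Sum>S | S \<in> Pow X - {{}} \<and> card S = k. g (card S))"
    using assms
    by (intro sum.group[symmetric])
       (auto simp: card_mono Suc_le_eq card_gt_0_iff finite_subset)
  also have "\<dots> = (\<Sum>k=1..card X. of_nat (card X choose k) * g k)"
  proof (intro sum.cong refl)
    fix k assume k: "k \<in> {1..card X}"
    have "{S \<in> Pow X - {{}}. card S = k} = {S. S \<subseteq> X \<and> card S = k}" using k by auto
    then show "(\<Sum>S | S \<in> Pow X - {{}} \<and> card S = k. g (card S)) = of_nat (card X choose k) * g k"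
      using n_subsets[OF assms, of k] by simp
  qed
  finally show ?thesis .
qed

text \<open>Grouping subsets by cardinality gives the derivative the shape of the source recurrence:
  differentiating a factor corresponds to deleting nonempty sets of sources from that part.\<close>

lemma pderiv_part_poly_card:
  assumes "finite X"
  shows "pderiv (part_poly (card X)) =
    (\<Sum>S\<in>Pow X - {{}}. smult ((- 1) ^ (card S + 1)) (part_poly (card (X - S))))"
proof -
  have "(\<Sum>S\<in>Pow X - {{}}. smult ((- 1) ^ (card S + 1)) (part_poly (card (X - S)))) =
     (\<Sum>S\<in>Pow X - {{}}. smult ((- 1) ^ (card S + 1)) (part_poly (card X - card S)))"
    using assms by (intro sum.cong refl) (auto simp: card_Diff_subset finite_subset)
  also have "\<dots> = pderiv (part_poly (card X))"
    unfolding pderiv_part_poly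
    by (subst sum_nonempty_subsets_card[OF assms])
       (simp add: mult.commute of_nat_poly)
  finally show ?thesis ..
qed

text \<open>This is \<open>\<integral>\<^sub>0\<^sup>\<infinity> exp (-t) p(t) dt\<close> written algebraically.\<close>

definition factorial_functional :: "complex poly \<Rightarrow> complex" where
  "factorial_functional p = (\<Sum>m\<le>degree p. coeff p m * fact m)"

section \<open>Calculus of the factorial functional\<close>

lemma factorial_functional_bound:
  "degree p \<le> n \<Longrightarrow> factorial_functional p = (\<Sum>m\<le>n. coeff p m * fact m)"
  unfolding factorial_functional_def
  by (intro sum.mono_neutral_left) (auto simp: coeff_eq_0)

lemma factorial_functional_add:
  "factorial_functional (p + r) = factorial_functional p + factorial_functional r"
proof -
  define n where "n = max (degree p) (degree r)"
  have "degree (p + r) \<le> n" by (simp add: n_def degree_add_le_max)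
  then show ?thesis using factorial_functional_bound[of _ n]
    by (simp add: n_def sum.distrib algebra_simps)
qed

lemma factorial_functional_smult:
  "factorial_functional (smult c p) = c * factorial_functional p"
  using factorial_functional_bound[OF degree_smult_le, of c p]
  by (simp add: factorial_functional_def sum_distrib_left mult.assoc)

lemma factorial_functional_sum:
  "factorial_functional (\<Sum>i\<in>A. f i) = (\<Sum>i\<in>A. factorial_functional (f i))"
  by (induction A rule: infinite_finite_induct)
     (auto simp: factorial_functional_add, simp_all add: factorial_functional_def)

text \<open>Integration by parts against \<open>exp (-t)\<close>; algebraically it is
  \<open>fact (m + 1) = (m + 1) * fact m\<close>.\<close>

lemma factorial_functional_pderiv:
  "factorial_functional (pderiv p) = factorial_functional p - poly p 0"
proof -
  have "factorial_functional p = (\<Sum>m\<le>Suc (degree p). coeff p m * fact m)"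
    by (rule factorial_functional_bound) simp
  also have "\<dots> = coeff p 0 + (\<Sum>m\<le>degree p. coeff p (Suc m) * fact (Suc m))"
    by (subst sum.atMost_Suc_shift) simp
  also have "(\<Sum>m\<le>degree p. coeff p (Suc m) * fact (Suc m)) =
     (\<Sum>m\<le>degree p. coeff (pderiv p) m * fact m)"
    by (simp add: coeff_pderiv algebra_simps)
  also have "\<dots> = factorial_functional (pderiv p)"
    by (rule factorial_functional_bound[symmetric]) (simp add: degree_pderiv)
  finally show ?thesis by (simp add: poly_0_coeff_0)
qed

text \<open>Induction on the number of vertices. By the product rule the right side of the source
  recurrence is the functional of the derivative of the product \<open>P\<close>; integration by
  parts turns it into the functional of \<open>P\<close> itself once
  \<open>poly P 0 = 0\<close>.\<close>

theorem AO_complete_multipartite_functional: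
  fixes W :: "nat \<Rightarrow> 'v set"
  assumes "disjoint_family_on W {1..q}" "\<And>j. j \<in> {1..q} \<Longrightarrow> finite (W j)"
  shows "of_nat (AO (complete_multipartite q W)) =
     factorial_functional (\<Prod>j\<in>{1..q}. part_poly (card (W j)))"
  using assms
proof (induction "\<Sum>j\<in>{1..q}. card (W j)" arbitrary: W rule: less_induct)
  case less
  show ?case
  proof (cases "(\<Union>j\<in>{1..q}. W j) = {}")
    case True
    then have "W j = {}" if "j \<in> {1..q}" for j using that by blast
    then have "(\<Prod>j\<in>{1..q}. part_poly (card (W j))) = (\<Prod>j\<in>{1..q}. 1)"
      by (intro prod.cong) auto
    then show ?thesis using AO_complete_multipartite_empty[OF True]
      by (simp add: factorial_functional_def)
  next
    case False
    define P where "P = (\<Prod>j\<in>{1..q}. part_poly (card (W j)))"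
    define Q where "Q = (\<lambda>j. \<Prod>i\<in>{1..q} - {j}. part_poly (card (W i)))"
    have step: "of_nat (AO (complete_multipartite q (W(j := W j - S)))) =
       factorial_functional (Q j * part_poly (card (W j - S)))"
      if j: "j \<in> {1..q}" and S: "S \<in> Pow (W j) - {{}}" for j S
    proof -
      define W' where "W' = W(j := W j - S)"
      have sub: "W' i \<subseteq> W i" for i by (auto simp: W'_def)
      have disj: "disjoint_family_on W' {1..q}"
        using less.prems(1) sub unfolding disjoint_family_on_def
        by (metis Int_mono subset_empty)
      have fin: "finite (W' i)" if "i \<in> {1..q}" for i
        using less.prems(2)[OF that] sub finite_subset by blast
      have "W' j \<subset> W j" using S by (auto simp: W'_def)
      then have "card (W' j) < card (W j)" using less.prems(2)[OF j] by (rule psubset_card_mono[rotated])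
      then have lt: "(\<Sum>i\<in>{1..q}. card (W' i)) < (\<Sum>i\<in>{1..q}. card (W i))"
        by (intro sum_strict_mono_ex1) (use j sub less.prems(2) in \<open>auto intro!: card_mono\<close>)
      have "of_nat (AO (complete_multipartite q W')) =
          factorial_functional (\<Prod>i\<in>{1..q}. part_poly (card (W' i)))"
        by (rule less.hyps[OF lt disj fin])
      also have "(\<Prod>i\<in>{1..q}. part_poly (card (W' i))) =
          part_poly (card (W' j)) * (\<Prod>i\<in>{1..q} - {j}. part_poly (card (W' i)))"
        by (rule prod.remove) (use j in auto)
      also have "(\<Prod>i\<in>{1..q} - {j}. part_poly (card (W' i))) = Q j"
        unfolding Q_def by (intro prod.cong) (auto simp: W'_def)
      also have "W' j = W j - S" by (simp add: W'_def)
      finally show ?thesis unfolding W'_def by (simp only: mult.commute)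
    qed
    have "of_nat (AO (complete_multipartite q W)) =
       (of_int (int (AO (complete_multipartite q W))) :: complex)" by simp
    also have "int (AO (complete_multipartite q W)) = (\<Sum>j\<in>{1..q}. \<Sum>S\<in>Pow (W j) - {{}}.
       (-1) ^ (card S + 1) * int (AO (complete_multipartite q (W(j := W j - S)))))"
      by (rule AO_complete_multipartite_rec[OF less.prems(1) less.prems(2) False])
    also have "of_int \<dots> = (\<Sum>j\<in>{1..q}. \<Sum>S\<in>Pow (W j) - {{}}.
       (-1) ^ (card S + 1) * factorial_functional (Q j * part_poly (card (W j - S))))"
      unfolding of_int_sum by (intro sum.cong refl) (simp add: step[symmetric])
    also have "\<dots> = factorial_functional (\<Sum>j\<in>{1..q}. Q j * pderiv (part_poly (card (W j))))"
      unfolding factorial_functional_sum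
    proof (intro sum.cong refl)
      fix j assume j: "j \<in> {1..q}"
      show "(\<Sum>S\<in>Pow (W j) - {{}}. (-1) ^ (card S + 1) *
              factorial_functional (Q j * part_poly (card (W j - S)))) =
            factorial_functional (Q j * pderiv (part_poly (card (W j))))"
        unfolding pderiv_part_poly_card[OF less.prems(2)[OF j]] sum_distrib_left
          factorial_functional_sum mult_smult_right factorial_functional_smult ..
    qed
    also have "(\<Sum>j\<in>{1..q}. Q j * pderiv (part_poly (card (W j)))) = pderiv P"
      unfolding P_def Q_def by (rule pderiv_prod[symmetric])
    also have "factorial_functional (pderiv P) = factorial_functional P - poly P 0"
      by (rule factorial_functional_pderiv)
    also have "poly P 0 = 0"
    proof -
      \<comment> \<open>A nonempty part supplies a factor vanishing at 0; this is where nonemptiness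
        of the graph is used.\<close>
      obtain j where j: "j \<in> {1..q}" "W j \<noteq> {}" using False by blast
      then have "card (W j) > 0" using less.prems(2) by (simp add: card_gt_0_iff)
      then show ?thesis using j unfolding P_def poly_prod
        by (intro prod_zero) (auto intro!: bexI[of _ j] simp: poly_part_poly_0)
    qed
    finally show ?thesis by (simp add: P_def)
  qed
qed

lemma has_bochner_integral_power_times_exp:
  "has_bochner_integral lborel (\<lambda>t :: real. indicator {0..} t * (t ^ m * exp (- t))) (fact m)"
  by (rule has_bochner_integral_nn_integral)
     (use nn_intergal_power_times_exp_Ici[of m] in
       \<open>auto simp: mult.commute indicator_mult_ennreal intro!: AE_I2 split: split_indicator\<close>)

lemma has_bochner_integral_factorial_functional:
  "has_bochner_integral lborel
     (\<lambda>t. indicator {0..} t *\<^sub>R (of_real (exp (- t)) * poly p (of_real t))) (factorial_functional p)"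
proof -
  have "has_bochner_integral lborel
     (\<lambda>t. \<Sum>m\<le>degree p. coeff p m * of_real (indicator {0..} t * (t ^ m * exp (- t))))
     (\<Sum>m\<le>degree p. coeff p m * of_real (fact m))"
    by (intro has_bochner_integral_sum has_bochner_integral_mult_right
        has_bochner_integral_of_real has_bochner_integral_power_times_exp)
  moreover have "(\<Sum>m\<le>degree p. coeff p m * of_real (indicator {0..} t * (t ^ m * exp (- t)))) =
     indicator {0..} t *\<^sub>R (of_real (exp (- t)) * poly p (of_real t))" for t
    unfolding poly_altdef sum_distrib_left scaleR_sum_right
    by (intro sum.cong refl) (simp add: scaleR_conv_of_real ac_simps)
  ultimately show ?thesis by (simp add: factorial_functional_def)
qed

section \<open>Local limit theorem for Fourier integrals\<close>

text \<open>If \<open>\<phi>\<close> is the logarithm of the characteristic function of an integer-valued random variable, this is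
  the mass at the integer \<open>x\<close> of its \<open>t\<close>-fold convolution power. No positivity is required below: for
  the exponent coming from \<open>1 - exp (-x)\<close> the masses may be negative.\<close>

definition lattice_density :: "(real \<Rightarrow> complex) \<Rightarrow> real \<Rightarrow> real \<Rightarrow> complex" where
  "lattice_density \<phi> t x =
     (LINT \<theta>:{-pi..pi}|lborel. exp (of_real t * \<phi> \<theta> - \<i> * of_real (x * \<theta>))) / of_real (2 * pi)"

text \<open>Cauchy's coefficient formula on the circle of radius \<open>r\<close>, in the form of a
  Lebesgue integral over a symmetric period.\<close>

lemma fps_nth_circle_integral:
  fixes f :: "complex \<Rightarrow> complex"
  assumes f: "f holomorphic_on UNIV" "f has_fps_expansion F" and r: "r > 0"
  shows "(LINT \<theta>:{-pi..pi}|lborel. f (of_real r * exp (\<i> * of_real \<theta>)) *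
            exp (- \<i> * of_real (real n * \<theta>))) = of_real (2 * pi * r ^ n) * fps_nth F n"
proof -
  define g where "g = (\<lambda>\<theta>. f (of_real r * exp (\<i> * of_real \<theta>)) * exp (- \<i> * of_real (real n * \<theta>)))"
  \<comment> \<open>Reflecting the argument moves the parameter interval \<open>{0..2 * pi}\<close> of the circle to \<open>{-pi..pi}\<close>.\<close>
  define h where "h = (\<lambda>z. f (- z))"
  have f': "f holomorphic_on A" for A using f(1) by (rule holomorphic_on_subset) simp
  have hol: "h holomorphic_on UNIV" unfolding h_def
    by (intro holomorphic_on_compose_gen[of uminus UNIV f UNIV, unfolded o_def] holomorphic_intros f) auto
  have "h has_fps_expansion (F oo (- fps_X))"
    using has_fps_expansion_compose[OF f(2) has_fps_expansion_minus[OF has_fps_expansion_fps_X]]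
    by (simp add: h_def o_def)
  then have "(deriv ^^ n) h 0 / fact n = fps_nth (F oo (- fps_X)) n"
    by (rule fps_nth_fps_expansion[symmetric])
  also have "\<dots> = (- 1) ^ n * fps_nth F n" by (simp add: fps_compose_uminus')
  finally have deriv: "(deriv ^^ n) h 0 / fact n = (- 1) ^ n * fps_nth F n" .
  have "((\<lambda>u. h u / (u - 0) ^ Suc n) has_contour_integral ((2 * pi * \<i>) / fact n * (deriv ^^ n) h 0))
      (circlepath 0 r)"
    by (rule Cauchy_has_contour_integral_higher_derivative_circlepath)
       (use r hol in \<open>auto intro: holomorphic_on_imp_continuous_on holomorphic_on_subset\<close>)
  also have "(2 * pi * \<i>) / fact n * (deriv ^^ n) h 0 = 2 * pi * \<i> * ((- 1) ^ n * fps_nth F n)"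
    unfolding deriv[symmetric] by simp
  finally have "((\<lambda>t. h (of_real r * cis t) / (of_real r * cis t) ^ Suc n * of_real r * \<i> * cis t)
      has_integral (2 * pi * \<i> * ((- 1) ^ n * fps_nth F n))) {0..2 * pi}"
    unfolding circlepath_def by (subst (asm) has_contour_integral_part_circlepath_iff) simp_all
  \<comment> \<open>The multiplier removes the factor \<open>\<i>\<close> of \<open>dz\<close>,
    restores \<open>r ^ n\<close>, and compensates the sign that reflection puts on the
    coefficient.\<close>
  then have int: "((\<lambda>t. h (of_real r * cis t) / (of_real r * cis t) ^ Suc n * of_real r * \<i> * cis t *
        (- \<i> * (- 1) ^ n * of_real r ^ n))
      has_integral (2 * pi * \<i> * ((- 1) ^ n * fps_nth F n) * (- \<i> * (- 1) ^ n * of_real r ^ n))) {0..2 * pi}"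
    by (rule has_integral_mult_left)
  have val: "2 * pi * \<i> * ((- 1) ^ n * fps_nth F n) * (- \<i> * (- 1) ^ n * of_real r ^ n) =
      of_real (2 * pi * r ^ n) * fps_nth F n"
    by (simp add: mult_ac flip: power_mult_distrib)
  have fn: "(\<lambda>t. h (of_real r * cis t) / (of_real r * cis t) ^ Suc n * of_real r * \<i> * cis t *
        (- \<i> * (- 1) ^ n * of_real r ^ n)) = (\<lambda>t. g (t + - pi))"
  proof
    fix t
    have e: "exp (\<i> * of_real (t + - pi)) = - cis t"
      by (simp add: cis_conv_exp distrib_left right_diff_distrib exp_diff)
    have "exp (- \<i> * of_real (real n * (t + - pi))) = inverse (exp (\<i> * of_real (t + - pi)) ^ n)"
      by (simp add: exp_minus mult_ac flip: exp_of_nat_mult)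
    also have "\<dots> = inverse ((- 1) ^ n * cis t ^ n)"
      unfolding e by (simp flip: power_mult_distrib)
    also have "\<dots> = (- 1) ^ n / cis t ^ n"
      by (simp add: divide_inverse flip: power_inverse)
    finally have e2: "exp (- \<i> * of_real (real n * (t + - pi))) = (- 1) ^ n / cis t ^ n" .
    show "h (of_real r * cis t) / (of_real r * cis t) ^ Suc n * of_real r * \<i> * cis t *
        (- \<i> * (- 1) ^ n * of_real r ^ n) = g (t + - pi)"
      unfolding g_def e2 e h_def using r by (simp add: field_simps)
  qed
  have "(g has_integral of_real (2 * pi * r ^ n) * fps_nth F n) {-pi..pi}"
    using int unfolding val fn
    using has_integral_shift_real_ivl_iff[of g _ "- pi" pi "- pi"] by simp
  moreover have "continuous_on {-pi..pi} g" unfolding g_def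
    by (intro continuous_intros continuous_on_compose2[OF holomorphic_on_imp_continuous_on[OF f(1)]])
       auto
  then have "set_integrable lborel {-pi..pi} g" by (rule borel_integrable_atLeastAtMost')
  ultimately have "(LINT \<theta>:{-pi..pi}|lborel. g \<theta>) = of_real (2 * pi * r ^ n) * fps_nth F n"
    by (simp add: set_borel_integral_eq_integral(2) integral_unique)
  then show ?thesis by (simp add: g_def)
qed

section \<open>Gaussian integrals and second-order expansion\<close>

lemma has_bochner_integral_gaussian_fourier:
  assumes "v > 0"
  shows "has_bochner_integral lborel (\<lambda>u. exp (\<i> * of_real (y * u) - of_real (v * u\<^sup>2 / 2)))
     (of_real (sqrt (2 * pi / v) * exp (- y\<^sup>2 / (2 * v))))"
proof -
  interpret real_distribution std_normal_distribution by (rule real_dist_normal_dist)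
  \<comment> \<open>The substitution \<open>x = sqrt v * u\<close> turns the characteristic function
    of the standard normal law at \<open>z\<close> into the integral wanted.\<close>
  define z where "z = y / sqrt v"
  have "integrable std_normal_distribution (\<lambda>x. iexp (z * x))"
    by (rule integrable_const_bound[where B = 1]) auto
  moreover have "(LINT x|std_normal_distribution. iexp (z * x)) = of_real (exp (- (z\<^sup>2) / 2))"
    using char_std_normal_distribution[THEN fun_cong, of z] by (simp add: char_def)
  ultimately have "has_bochner_integral std_normal_distribution (\<lambda>x. iexp (z * x)) (of_real (exp (- (z\<^sup>2) / 2)))"
    by (simp add: has_bochner_integral_iff)
  then have "has_bochner_integral lborel (\<lambda>x. std_normal_density x *\<^sub>R iexp (z * x)) (of_real (exp (- (z\<^sup>2) / 2)))"
    by (simp add: has_bochner_integral_iff integrable_density integral_density)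
  then have "has_bochner_integral lborel (\<lambda>u. std_normal_density (0 + sqrt v * u) *\<^sub>R iexp (z * (0 + sqrt v * u)))
      (of_real (exp (- (z\<^sup>2) / 2)) /\<^sub>R \<bar>sqrt v\<bar>)"
    using assms by (intro lborel_has_bochner_integral_real_affine_iff[THEN iffD1]) auto
  then have "has_bochner_integral lborel (\<lambda>u. sqrt (2 * pi) *\<^sub>R (std_normal_density (0 + sqrt v * u) *\<^sub>R iexp (z * (0 + sqrt v * u))))
      (sqrt (2 * pi) *\<^sub>R (of_real (exp (- (z\<^sup>2) / 2)) /\<^sub>R \<bar>sqrt v\<bar>))"
    by (rule has_bochner_integral_scaleR_right)
  moreover have "sqrt (2 * pi) *\<^sub>R (std_normal_density (0 + sqrt v * u) *\<^sub>R iexp (z * (0 + sqrt v * u))) =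
      exp (\<i> * of_real (y * u) - of_real (v * u\<^sup>2 / 2))" for u
  proof -
    have 1: "sqrt (2 * pi) * std_normal_density (0 + sqrt v * u) = exp (- (v * u\<^sup>2 / 2))"
      using assms by (simp add: std_normal_density_def power_mult_distrib)
    have 2: "z * (0 + sqrt v * u) = y * u" using assms by (simp add: z_def)
    have "exp (\<i> * of_real (y * u) - of_real (v * u\<^sup>2 / 2)) =
        exp (of_real (- (v * u\<^sup>2 / 2))) * iexp (y * u)"
      by (simp only: mult_exp_exp) (simp add: algebra_simps)
    then show ?thesis unfolding 2 scaleR_scaleR 1 by (simp only: scaleR_conv_of_real exp_of_real)
  qed
  moreover have "sqrt (2 * pi) *\<^sub>R ((of_real (exp (- (z\<^sup>2) / 2)) :: complex) /\<^sub>R \<bar>sqrt v\<bar>) =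
     of_real (sqrt (2 * pi / v) * exp (- y\<^sup>2 / (2 * v)))"
  proof -
    have "- (z\<^sup>2) / 2 = - y\<^sup>2 / (2 * v)" using assms by (simp add: z_def power_divide)
    moreover have "sqrt (2 * pi / v) = sqrt (2 * pi) * inverse \<bar>sqrt v\<bar>"
      by (subst real_sqrt_divide) (use assms in \<open>simp add: divide_inverse\<close>)
    ultimately show ?thesis unfolding scaleR_conv_of_real of_real_mult[symmetric] by simp
  qed
  ultimately show ?thesis by simp
qed

lemma has_bochner_integral_gaussian:
  assumes "v > 0"
  shows "has_bochner_integral lborel (\<lambda>u. exp (- (v * u\<^sup>2))) (sqrt (pi / v))"
proof -
  have "has_bochner_integral lborel (\<lambda>u. Re (exp (\<i> * of_real (0 * u) - of_real (2 * v * u\<^sup>2 / 2))))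
     (Re (of_real (sqrt (2 * pi / (2 * v)) * exp (- 0\<^sup>2 / (2 * (2 * v))))))"
    using has_bochner_integral_gaussian_fourier[of "2 * v" 0] assms
    by (intro has_bochner_integral_Re) auto
  moreover have "Re (exp (\<i> * of_real (0 * u) - of_real (2 * v * u\<^sup>2 / 2))) = exp (- (v * u\<^sup>2))" for u
    by (simp add: Re_exp)
  ultimately show ?thesis by simp
qed

text \<open>Without its linear part, \<open>F\<close> vanishes to second order at 0, so the quotient
  by \<open>z ^ 2\<close> extends continuously with value the Taylor coefficient
  \<open>F2 0 / 2\<close>.\<close>

lemma tendsto_second_order_quotient:
  fixes F F1 F2 :: "complex \<Rightarrow> complex"
  assumes F: "\<And>z. (F has_field_derivative F1 z) (at z)"
    and F1: "\<And>z. (F1 has_field_derivative F2 z) (at z)"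
    and "F 0 = 0" "F2 0 \<noteq> 0"
  shows "((\<lambda>\<theta> :: real. (F (of_real \<theta>) - F1 0 * of_real \<theta>) / of_real (\<theta>\<^sup>2)) \<longlongrightarrow> F2 0 / 2) (at 0)"
proof -
  define G where "G = (\<lambda>z. F z - F1 0 * z)"
  have "F holomorphic_on UNIV" using F holomorphic_on_open[OF open_UNIV] by blast
  then have "G holomorphic_on UNIV" unfolding G_def by (intro holomorphic_intros)
  then have ana: "G analytic_on {0}" using analytic_on_open by (metis analytic_on_subset open_UNIV subset_UNIV)
  define \<Phi> where "\<Phi> = fps_expansion G 0"
  have \<Phi>: "G has_fps_expansion \<Phi>" unfolding \<Phi>_def
    by (rule analytic_at_imp_has_fps_expansion_0[OF ana])
  have d1: "deriv G = (\<lambda>z. F1 z - F1 0)" unfolding G_def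
    by (rule ext, rule DERIV_imp_deriv) (auto intro!: derivative_eq_intros F)
  have d2: "deriv (\<lambda>z. F1 z - F1 0) = F2"
    by (rule ext, rule DERIV_imp_deriv) (auto intro!: derivative_eq_intros F1)
  have n0: "fps_nth \<Phi> 0 = 0" using fps_nth_fps_expansion[OF \<Phi>, of 0] assms(3) by (simp add: G_def)
  have n1: "fps_nth \<Phi> 1 = 0" using fps_nth_fps_expansion[OF \<Phi>, of 1] by (simp add: d1)
  have n2: "fps_nth \<Phi> 2 = F2 0 / 2"
    using fps_nth_fps_expansion[OF \<Phi>, of 2] by (simp add: d1 d2 numeral_2_eq_2)
  have "\<Phi> \<noteq> 0" using n2 assms(4) by auto
  moreover have "fps_nth \<Phi> i = 0" if "i < 2" for i using that n0 n1 by (cases i) auto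
  ultimately have "2 \<le> subdegree \<Phi>" by (intro subdegree_geI)
  then have "(\<lambda>z. if z = 0 then F2 0 / 2 else G z / z ^ 2) has_fps_expansion fps_shift 2 \<Phi>"
    by (rule has_fps_expansion_shift[OF \<Phi>]) (simp add: n2)
  then have "isCont (\<lambda>z. if z = 0 then F2 0 / 2 else G z / z ^ 2) 0"
    by (rule has_fps_expansion_imp_continuous)
  then have "((\<lambda>z. if z = 0 then F2 0 / 2 else G z / z ^ 2) \<longlongrightarrow> F2 0 / 2) (at 0)"
    by (simp add: isCont_def)
  moreover have "filterlim (\<lambda>\<theta> :: real. complex_of_real \<theta>) (at 0) (at 0)"
    by (auto simp: filterlim_at intro!: tendsto_eq_intros eventually_at_filter[THEN iffD2])
  ultimately have "((\<lambda>\<theta> :: real. if complex_of_real \<theta> = 0 then F2 0 / 2 else G (of_real \<theta>) / of_real \<theta> ^ 2)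
      \<longlongrightarrow> F2 0 / 2) (at 0)"
    by (rule filterlim_compose)
  then show ?thesis
    by (rule Lim_transform_eventually) (auto simp: eventually_at_filter G_def)
qed

lemma sqrt_divide_eq_inverse_sqrt_mult:
  assumes "a > 0" "w > 0"
  shows "sqrt (a / w) / a = 1 / sqrt (a * w)"
proof -
  have "sqrt (a / w) * sqrt (a * w) = sqrt (a\<^sup>2)"
    unfolding real_sqrt_mult[symmetric] using assms by (simp add: power2_eq_square)
  then have "sqrt (a / w) * sqrt (a * w) = a" using assms by simp
  moreover have "sqrt (a * w) \<noteq> 0" using assms by simp
  ultimately show ?thesis using assms(1) by (simp add: frac_eq_eq del: real_sqrt_eq_0_iff)
qed

text \<open>\<open>\<mu>\<close> and \<open>v\<close> play the mean and variance of one step. Strict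
  negativity over the whole period is the analogue of aperiodicity: it excludes further peaks of
  \<open>exp (t * \<phi> \<theta>)\<close>.\<close>

locale lattice_exponent =
  fixes \<phi> :: "real \<Rightarrow> complex" and \<mu> v :: real
  assumes cont: "continuous_on {-pi..pi} \<phi>"
    and neg: "\<And>\<theta>. \<theta> \<in> {-pi..pi} \<Longrightarrow> \<theta> \<noteq> 0 \<Longrightarrow> Re (\<phi> \<theta>) < 0"
    and v: "v > 0"
    and lim: "((\<lambda>\<theta>. (\<phi> \<theta> - \<i> * of_real \<mu> * of_real \<theta>) / of_real (\<theta>\<^sup>2)) \<longlongrightarrow> - of_real v / 2) (at 0)"
    and zero: "\<phi> 0 = 0"
begin

text \<open>The linear term is imaginary, so \<open>Re (\<phi> \<theta>) / \<theta>\<^sup>2\<close>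
  extends continuously by \<open>- v / 2\<close> at 0. On the compact interval this negative
  function attains a negative maximum.\<close>

lemma Re_le_quadratic: "\<exists>c>0. \<forall>\<theta>\<in>{-pi..pi}. Re (\<phi> \<theta>) \<le> - c * \<theta>\<^sup>2"
proof -
  define g where "g = (\<lambda>\<theta>. if \<theta> = 0 then - v / 2 else Re (\<phi> \<theta>) / \<theta>\<^sup>2)"
  have "((\<lambda>\<theta>. Re ((\<phi> \<theta> - \<i> * of_real \<mu> * of_real \<theta>) / of_real (\<theta>\<^sup>2))) \<longlongrightarrow> Re (- of_real v / 2)) (at 0)"
    by (intro tendsto_Re lim)
  also have "(\<lambda>\<theta>. Re ((\<phi> \<theta> - \<i> * of_real \<mu> * of_real \<theta>) / of_real (\<theta>\<^sup>2))) = (\<lambda>\<theta>. Re (\<phi> \<theta>) / \<theta>\<^sup>2)"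
    by (simp add: fun_eq_iff)
  finally have "((\<lambda>\<theta>. Re (\<phi> \<theta>) / \<theta>\<^sup>2) \<longlongrightarrow> - v / 2) (at 0)" by simp
  then have g0: "(g \<longlongrightarrow> g 0) (at 0)"
    by (subst tendsto_cong[where g = "\<lambda>\<theta>. Re (\<phi> \<theta>) / \<theta>\<^sup>2"]) (auto simp: g_def eventually_at_filter)
  have "continuous_on {-pi..pi} g" unfolding continuous_on_eq_continuous_within
  proof
    fix \<theta> assume \<theta>: "\<theta> \<in> {-pi..pi}"
    show "continuous (at \<theta> within {-pi..pi}) g"
    proof (cases "\<theta> = 0")
      case True
      then show ?thesis using g0 by (auto simp: continuous_within intro: tendsto_within_subset)
    next
      case False
      have "continuous (at \<theta> within {-pi..pi}) (\<lambda>\<theta>. Re (\<phi> \<theta>) / \<theta>\<^sup>2)"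
        using cont \<theta> False by (auto simp: continuous_on_eq_continuous_within intro!: continuous_intros)
      moreover have "eventually (\<lambda>x. x \<noteq> 0) (at \<theta> within {-pi..pi})"
        using False by (intro eventually_neq_at_within)
      ultimately show ?thesis using False
        by (auto simp: continuous_within g_def elim!: Lim_transform_eventually eventually_mono)
    qed
  qed
  then obtain m where m: "m \<in> {-pi..pi}" "\<And>\<theta>. \<theta> \<in> {-pi..pi} \<Longrightarrow> g \<theta> \<le> g m"
    using continuous_attains_sup[of "{-pi..pi}" g] by auto
  have "g m < 0" using m(1) neg[of m] v by (auto simp: g_def divide_neg_pos)
  moreover have "Re (\<phi> \<theta>) \<le> - (- g m) * \<theta>\<^sup>2" if \<theta>: "\<theta> \<in> {-pi..pi}" for \<theta>
  proof (cases "\<theta> = 0")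
    case False
    then show ?thesis using m(2)[OF \<theta>] by (simp add: g_def divide_le_eq)
  qed (simp add: zero)
  ultimately show ?thesis by (intro exI[of _ "- g m"]) auto
qed

definition curv :: real where
  "curv = (SOME c. c > 0 \<and> (\<forall>\<theta>\<in>{-pi..pi}. Re (\<phi> \<theta>) \<le> - c * \<theta>\<^sup>2))"

lemma curv_pos: "curv > 0" and Re_le_curv: "\<theta> \<in> {-pi..pi} \<Longrightarrow> Re (\<phi> \<theta>) \<le> - curv * \<theta>\<^sup>2"
  using someI_ex[of "\<lambda>c. c > 0 \<and> (\<forall>\<theta>\<in>{-pi..pi}. Re (\<phi> \<theta>) \<le> - c * \<theta>\<^sup>2)"] Re_le_quadratic
  by (auto simp: curv_def)

lemma norm_exp_le:
  assumes "t > 0" "\<theta> \<in> {-pi..pi}"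
  shows "norm (exp (of_real t * \<phi> \<theta> - \<i> * of_real (x * \<theta>))) \<le> exp (- (curv * t * \<theta>\<^sup>2))"
  using mult_left_mono[OF Re_le_curv[OF assms(2)], of t] assms(1) by (simp add: mult_ac)

lemma set_integrable_exp:
  "set_integrable lborel {-pi..pi} (\<lambda>\<theta>. exp (of_real t * \<phi> \<theta> - \<i> * of_real (x * \<theta>)))"
  by (intro borel_integrable_atLeastAtMost' continuous_intros cont)

text \<open>The integrand is bounded by a Gaussian, whose integral over the whole line is explicit.
  The bound is uniform in \<open>x\<close> and serves near the peak.\<close>

lemma norm_lattice_density_le:
  assumes t: "t > 0"
  shows "norm (lattice_density \<phi> t x) \<le> sqrt (pi / curv) / sqrt t"
proof -
  have g: "has_bochner_integral lborel (\<lambda>u. exp (- (curv * t * u\<^sup>2))) (sqrt (pi / (curv * t)))"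
    using t curv_pos by (intro has_bochner_integral_gaussian) simp
  have "norm (LINT \<theta>:{-pi..pi}|lborel. exp (of_real t * \<phi> \<theta> - \<i> * of_real (x * \<theta>))) \<le>
      (LINT \<theta>|lborel. exp (- (curv * t * \<theta>\<^sup>2)))"
    unfolding set_lebesgue_integral_def
  proof (rule Bochner_Integration.integral_norm_bound_integral)
    show "integrable lborel (\<lambda>\<theta>. exp (- (curv * t * \<theta>\<^sup>2)))" using g by (simp add: has_bochner_integral_iff)
  qed (use set_integrable_exp norm_exp_le[OF t] in \<open>auto simp: set_integrable_def indicator_def\<close>)
  also have "\<dots> = sqrt (pi / (curv * t))" using g by (simp add: has_bochner_integral_iff)
  finally have "norm (lattice_density \<phi> t x) \<le> sqrt (pi / (curv * t)) / (2 * pi)"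
    unfolding lattice_density_def norm_divide norm_of_real by (simp add: divide_right_mono)
  also have "\<dots> \<le> sqrt (pi / (curv * t))"
    using pi_gt3 curv_pos t by (simp add: divide_le_eq)
  finally show ?thesis by (simp add: real_sqrt_divide real_sqrt_mult mult.commute)
qed

text \<open>Rescaling by \<open>\<theta> = u / r\<close> makes the integrand converge to a Gaussian
  of variance parameter \<open>\<tau> * v\<close> with frequency \<open>y\<close>; the quadratic
  bound on \<open>Re \<phi>\<close> provides a Gaussian majorant.\<close>

theorem lattice_density_tendsto:
  fixes t r x :: "nat \<Rightarrow> real"
  assumes r: "filterlim r at_top sequentially"
    and \<tau>: "(\<lambda>k. t k / (r k)\<^sup>2) \<longlonglongrightarrow> \<tau>" "\<tau> > 0"
    and y: "(\<lambda>k. (t k * \<mu> - x k) / r k) \<longlonglongrightarrow> y"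
  shows "(\<lambda>k. of_real (r k) * lattice_density \<phi> (t k) (x k)) \<longlonglongrightarrow>
     of_real (exp (- y\<^sup>2 / (2 * (\<tau> * v))) / sqrt (2 * pi * (\<tau> * v)))"
proof -
  have "eventually (\<lambda>k. r k > 0 \<and> t k / (r k)\<^sup>2 > \<tau> / 2) sequentially"
    using r[unfolded filterlim_at_top_dense, rule_format, of 0] order_tendstoD(1)[OF \<tau>(1), of "\<tau> / 2"] \<tau>(2)
    by (auto elim: eventually_elim2)
  then obtain K where K: "\<And>k. k \<ge> K \<Longrightarrow> r k > 0" "\<And>k. k \<ge> K \<Longrightarrow> t k / (r k)\<^sup>2 > \<tau> / 2"
    by (auto simp: eventually_sequentially)
  define e where "e = (\<lambda>k u. of_real (t k) * \<phi> (u / r k) - \<i> * of_real (x k * (u / r k)))"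
  define g where "g = (\<lambda>k u. indicator {-pi..pi} (u / r k) *\<^sub>R exp (e k u))"
  have resc: "of_real (r k) * lattice_density \<phi> (t k) (x k) = (LINT u|lborel. g k u) / of_real (2 * pi)"
    if "k \<ge> K" for k
  proof -
    have "(LINT \<theta>|lborel. indicator {-pi..pi} \<theta> *\<^sub>R exp (of_real (t k) * \<phi> \<theta> - \<i> * of_real (x k * \<theta>))) =
       \<bar>1 / r k\<bar> *\<^sub>R (LINT u|lborel. indicator {-pi..pi} (0 + 1 / r k * u) *\<^sub>R
          exp (of_real (t k) * \<phi> (0 + 1 / r k * u) - \<i> * of_real (x k * (0 + 1 / r k * u))))"
      using K(1)[OF that] by (intro lborel_integral_real_affine) auto
    then show ?thesis
      using K(1)[OF that] by (simp add: lattice_density_def set_lebesgue_integral_def g_def e_def scaleR_conv_of_real)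
  qed
  define G where "G = (\<lambda>u. exp (\<i> * of_real (y * u) - of_real (\<tau> * v * u\<^sup>2 / 2)))"
  have G: "has_bochner_integral lborel G (of_real (sqrt (2 * pi / (\<tau> * v)) * exp (- y\<^sup>2 / (2 * (\<tau> * v)))))"
    unfolding G_def using \<tau>(2) v by (intro has_bochner_integral_gaussian_fourier) simp
  have lim_g: "(\<lambda>k. g k u) \<longlonglongrightarrow> G u" for u
  proof -
    have r0: "(\<lambda>k. u / r k) \<longlonglongrightarrow> 0"
      by (rule tendsto_divide_0[OF tendsto_const filterlim_at_top_imp_at_infinity[OF r]])
    have "(\<lambda>k. e k u) \<longlonglongrightarrow> \<i> * of_real (y * u) - of_real (\<tau> * v * u\<^sup>2 / 2)"
    proof (cases "u = 0")
      case True
      then show ?thesis by (simp add: e_def zero)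
    next
      \<comment> \<open>For \<open>u \<noteq> 0\<close> the points \<open>u / r k\<close> approach 0
        through nonzero values, as the limit assumption requires. The exponent splits into
        \<open>t / r\<^sup>2 * u\<^sup>2\<close> times the second-order quotient plus a linear term
        with coefficient tending to \<open>y\<close>.\<close>
      case False
      have "filterlim (\<lambda>k. u / r k) (at 0) sequentially"
        using r0 False K(1) by (auto simp: filterlim_at eventually_sequentially intro!: exI[of _ K]) force
      note * = filterlim_compose[OF lim this]
      have "(\<lambda>k. of_real (t k / (r k)\<^sup>2 * u\<^sup>2) *
               ((\<phi> (u / r k) - \<i> * of_real \<mu> * of_real (u / r k)) / of_real ((u / r k)\<^sup>2)) +
               \<i> * of_real ((t k * \<mu> - x k) / r k * u))
          \<longlonglongrightarrow> of_real (\<tau> * u\<^sup>2) * (- of_real v / 2) + \<i> * of_real (y * u)"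
        by (intro tendsto_intros \<tau> y *)
      also have "of_real (\<tau> * u\<^sup>2) * (- of_real v / 2) + \<i> * of_real (y * u) =
          \<i> * of_real (y * u) - of_real (\<tau> * v * u\<^sup>2 / 2)"
        by simp
      finally show ?thesis
      proof (rule Lim_transform_eventually)
        show "\<forall>\<^sub>F k in sequentially. of_real (t k / (r k)\<^sup>2 * u\<^sup>2) *
               ((\<phi> (u / r k) - \<i> * of_real \<mu> * of_real (u / r k)) / of_real ((u / r k)\<^sup>2)) +
               \<i> * of_real ((t k * \<mu> - x k) / r k * u) = e k u"
          using eventually_ge_at_top[of K]
        proof eventually_elim
          case (elim k)
          then have "r k \<noteq> 0" using K(1) by force
          then show ?case using False by (simp add: e_def field_simps power2_eq_square)
        qed
      qed
    qed
    then have "(\<lambda>k. exp (e k u)) \<longlonglongrightarrow> G u" unfolding G_def by (rule tendsto_exp)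
    moreover have "eventually (\<lambda>k. u / r k \<in> {-pi<..<pi}) sequentially"
      by (rule topological_tendstoD[OF r0]) auto
    then have "eventually (\<lambda>k. exp (e k u) = g k u) sequentially"
      by eventually_elim (auto simp: g_def)
    ultimately show ?thesis by (rule Lim_transform_eventually)
  qed
  have meas: "g k \<in> borel_measurable lborel" for k
  proof -
    have "(\<lambda>\<theta>. indicator {-pi..pi} \<theta> *\<^sub>R exp (of_real (t k) * \<phi> \<theta> - \<i> * of_real (x k * \<theta>)))
      \<in> borel_measurable borel"
      using set_integrable_exp[of "t k" "x k"] by (auto simp: set_integrable_def)
    then have "(\<lambda>\<theta>. indicator {-pi..pi} \<theta> *\<^sub>R exp (of_real (t k) * \<phi> \<theta> - \<i> * of_real (x k * \<theta>))) \<circ> (\<lambda>u. u / r k)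
      \<in> borel_measurable borel"
      by (intro measurable_comp[where N = borel]) auto
    then show ?thesis by (simp add: g_def e_def o_def)
  qed
  have dom: "norm (g k u) \<le> exp (- (curv * (\<tau> / 2) * u\<^sup>2))" if k: "k \<ge> K" for k u
  proof (cases "u / r k \<in> {-pi..pi}")
    case True
    have "t k > 0" using K[OF k] \<tau>(2) by (smt (verit) divide_nonpos_nonneg half_gt_zero zero_le_power2)
    then have "norm (g k u) \<le> exp (- (curv * t k * (u / r k)\<^sup>2))"
      using norm_exp_le[OF _ True, of "t k" "x k"] True by (simp add: g_def e_def)
    also have "curv * (\<tau> / 2) * u\<^sup>2 \<le> curv * t k * (u / r k)\<^sup>2"
    proof -
      have "(\<tau> / 2) * u\<^sup>2 \<le> t k / (r k)\<^sup>2 * u\<^sup>2"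
        by (intro mult_right_mono less_imp_le[OF K(2)[OF k]]) auto
      from mult_left_mono[OF this, of curv] show ?thesis using curv_pos
        by (simp add: power_divide mult_ac)
    qed
    then have "exp (- (curv * t k * (u / r k)\<^sup>2)) \<le> exp (- (curv * (\<tau> / 2) * u\<^sup>2))" by simp
    finally show ?thesis .
  qed (auto simp: g_def)
  \<comment> \<open>The majorant is valid only from \<open>K\<close> on, hence the shifted
    sequence.\<close>
  have "(\<lambda>k. LINT u|lborel. g (k + K) u) \<longlonglongrightarrow> (LINT u|lborel. G u)"
  proof (rule integral_dominated_convergence)
    show "integrable lborel (\<lambda>u. exp (- (curv * (\<tau> / 2) * u\<^sup>2)))"
      using has_bochner_integral_gaussian[of "curv * (\<tau> / 2)"] curv_pos \<tau>(2)
      by (simp add: has_bochner_integral_iff)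
    show "AE u in lborel. (\<lambda>k. g (k + K) u) \<longlonglongrightarrow> G u"
      using LIMSEQ_ignore_initial_segment[OF lim_g] by auto
    show "G \<in> borel_measurable lborel" using G by (auto simp: has_bochner_integral_iff)
  qed (use meas dom in auto)
  then have "(\<lambda>k. LINT u|lborel. g k u) \<longlonglongrightarrow> (LINT u|lborel. G u)" by (rule LIMSEQ_offset)
  then have "(\<lambda>k. (LINT u|lborel. g k u) / of_real (2 * pi)) \<longlonglongrightarrow> (LINT u|lborel. G u) / of_real (2 * pi)"
    by (intro tendsto_divide tendsto_const) auto
  moreover have "(LINT u|lborel. G u) / of_real (2 * pi) =
      of_real (exp (- y\<^sup>2 / (2 * (\<tau> * v))) / sqrt (2 * pi * (\<tau> * v)))"
  proof -
    have "sqrt (2 * pi / (\<tau> * v)) / (2 * pi) = 1 / sqrt (2 * pi * (\<tau> * v))"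
      using \<tau>(2) v by (intro sqrt_divide_eq_inverse_sqrt_mult) auto
    then have "sqrt (2 * pi / (\<tau> * v)) * exp (- y\<^sup>2 / (2 * (\<tau> * v))) / (2 * pi) =
        exp (- y\<^sup>2 / (2 * (\<tau> * v))) / sqrt (2 * pi * (\<tau> * v))"
      by (metis mult.commute times_divide_eq_left mult.right_neutral times_divide_eq_right)
    then show ?thesis using G by (simp only: has_bochner_integral_iff flip: of_real_divide)
  qed
  ultimately have "(\<lambda>k. (LINT u|lborel. g k u) / of_real (2 * pi)) \<longlonglongrightarrow>
      of_real (exp (- y\<^sup>2 / (2 * (\<tau> * v))) / sqrt (2 * pi * (\<tau> * v)))" by simp
  then show ?thesis
    by (rule Lim_transform_eventually) (auto simp: eventually_sequentially resc intro!: exI[of _ K])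
qed

text \<open>Integration by parts; the boundary terms cancel because \<open>n\<close> is an integer.\<close>

lemma norm_lattice_density_le_inverse:
  fixes \<phi>' :: "real \<Rightarrow> complex" and n :: nat
  assumes deriv: "\<And>\<theta>. (\<phi> has_vector_derivative \<phi>' \<theta>) (at \<theta>)"
    and cont': "continuous_on {-pi..pi} \<phi>'" and per: "\<phi> (- pi) = \<phi> pi"
    and lip: "\<And>\<theta>. \<theta> \<in> {-pi..pi} \<Longrightarrow> norm (\<phi>' \<theta> - \<i> * of_real \<mu>) \<le> C * \<bar>\<theta>\<bar>"
    and t: "t > 0"
  shows "\<bar>real n - t * \<mu>\<bar> * norm (lattice_density \<phi> t (real n)) \<le> C * sqrt (2 * pi) / curv"
proof -
  define E where "E = (\<lambda>\<theta>. exp (of_real t * \<phi> \<theta> - \<i> * of_real (real n * \<theta>)))"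
  define J where "J = (LINT \<theta>:{-pi..pi}|lborel. E \<theta>)"
  have "0 \<le> C * \<bar>pi\<bar>" using lip[of pi] by (auto intro: order_trans[OF norm_ge_zero])
  then have C: "C \<ge> 0" using pi_gt_zero by (auto simp: zero_le_mult_iff)
  have contE: "continuous_on {-pi..pi} E" unfolding E_def by (intro continuous_intros cont)
  have intE: "set_integrable lborel {-pi..pi} E" using contE by (rule borel_integrable_atLeastAtMost')
  have intE': "set_integrable lborel {-pi..pi} (\<lambda>\<theta>. (\<phi>' \<theta> - \<i> * of_real \<mu>) * E \<theta>)"
    by (intro borel_integrable_atLeastAtMost' continuous_intros contE cont')
  have "(E has_vector_derivative E \<theta> * (of_real t * \<phi>' \<theta> - \<i> * of_real (real n))) (at \<theta>)" for \<theta>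
  proof -
    have "((\<lambda>\<theta>. of_real t * \<phi> \<theta> - \<i> * of_real (real n * \<theta>)) has_vector_derivative
        of_real t * \<phi>' \<theta> - \<i> * of_real (real n)) (at \<theta>)"
      by (rule derivative_eq_intros deriv refl has_vector_derivative_of_real
          | simp add: has_real_derivative_iff_has_vector_derivative[symmetric])+
    then show ?thesis unfolding E_def
      using field_vector_diff_chain_at[OF _ DERIV_exp] by (simp add: o_def mult.commute)
  qed
  then have "(LINT \<theta>|lborel. indicator {-pi..pi} \<theta> *\<^sub>R (E \<theta> * (of_real t * \<phi>' \<theta> - \<i> * of_real (real n)))) =
      E pi - E (- pi)"
    by (intro integral_FTC_atLeastAtMost continuous_intros contE cont')
       (auto intro: has_vector_derivative_at_within)
  also have "E (- pi) = E pi"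
  proof -
    have "exp (\<i> * of_real (real n * pi)) = exp (- (\<i> * of_real (real n * pi)))"
      by (intro exp_eq[THEN iffD2]) (auto intro!: exI[of _ "int n"])
    then show ?thesis by (simp add: E_def per exp_diff exp_minus field_simps)
  qed
  \<comment> \<open>The derivative of \<open>E\<close> integrates to zero; its factor
    \<open>t * \<phi>' - \<i> * n\<close> is split at the mean into
    \<open>t * (\<phi>' - \<i> * \<mu>) - \<i> * (n - t * \<mu>)\<close>.\<close>
  finally have "0 = (LINT \<theta>:{-pi..pi}|lborel. of_real t * ((\<phi>' \<theta> - \<i> * of_real \<mu>) * E \<theta>) -
       \<i> * of_real (real n - t * \<mu>) * E \<theta>)"
    by (simp add: set_lebesgue_integral_def algebra_simps)
  also have "\<dots> = of_real t * (LINT \<theta>:{-pi..pi}|lborel. (\<phi>' \<theta> - \<i> * of_real \<mu>) * E \<theta>) -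
       \<i> * of_real (real n - t * \<mu>) * J"
    using intE intE' by (simp add: J_def)
  finally have "norm (\<i> * of_real (real n - t * \<mu>) * J) =
      norm (of_real t * (LINT \<theta>:{-pi..pi}|lborel. (\<phi>' \<theta> - \<i> * of_real \<mu>) * E \<theta>))"
    by simp
  then have eq: "\<bar>real n - t * \<mu>\<bar> * norm J =
      t * norm (LINT \<theta>:{-pi..pi}|lborel. (\<phi>' \<theta> - \<i> * of_real \<mu>) * E \<theta>)"
    using t by (simp add: norm_mult del: of_real_diff of_real_mult)
  define s where "s = sqrt (curv * t)"
  have s: "s > 0" "s\<^sup>2 = curv * t" using curv_pos t by (auto simp: s_def)
  have g: "has_bochner_integral lborel (\<lambda>u. exp (- (s\<^sup>2 / 2 * u\<^sup>2))) (sqrt (pi / (s\<^sup>2 / 2)))"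
    using s(1) by (intro has_bochner_integral_gaussian) simp
  have pw: "norm ((\<phi>' \<theta> - \<i> * of_real \<mu>) * E \<theta>) \<le> C / s * exp (- (s\<^sup>2 / 2 * \<theta>\<^sup>2))"
    if \<theta>: "\<theta> \<in> {-pi..pi}" for \<theta>
  proof -
    \<comment> \<open>Half of the Gaussian decay is spent on absorbing the linear factor from the
      Lipschitz bound, which gains \<open>1 / s\<close>.\<close>
    have "s * \<bar>\<theta>\<bar> \<le> 1 + (s * \<bar>\<theta>\<bar>)\<^sup>2 / 2" using zero_le_power2[of "s * \<bar>\<theta>\<bar> - 1"]
      by (simp add: power2_diff)
    also have "\<dots> \<le> exp ((s * \<bar>\<theta>\<bar>)\<^sup>2 / 2)" by (rule exp_ge_add_one_self)
    finally have "\<bar>\<theta>\<bar> \<le> exp (s\<^sup>2 / 2 * \<theta>\<^sup>2) / s" using s by (simp add: field_simps)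
    then have "C * \<bar>\<theta>\<bar> \<le> C * (exp (s\<^sup>2 / 2 * \<theta>\<^sup>2) / s)" using C by (rule mult_left_mono)
    then have "norm (\<phi>' \<theta> - \<i> * of_real \<mu>) \<le> C / s * exp (s\<^sup>2 / 2 * \<theta>\<^sup>2)"
      using lip[OF \<theta>] by simp
    moreover have "norm (E \<theta>) \<le> exp (- (s\<^sup>2 * \<theta>\<^sup>2))"
      unfolding E_def s by (rule norm_exp_le[OF t \<theta>])
    ultimately have "norm ((\<phi>' \<theta> - \<i> * of_real \<mu>) * E \<theta>) \<le>
        C / s * exp (s\<^sup>2 / 2 * \<theta>\<^sup>2) * exp (- (s\<^sup>2 * \<theta>\<^sup>2))"
      unfolding norm_mult using C s by (intro mult_mono) auto
    also have "\<dots> = C / s * exp (- (s\<^sup>2 / 2 * \<theta>\<^sup>2))"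
      by (simp add: mult_exp_exp)
    finally show ?thesis .
  qed
  have "norm (LINT \<theta>:{-pi..pi}|lborel. (\<phi>' \<theta> - \<i> * of_real \<mu>) * E \<theta>) \<le>
      (LINT \<theta>|lborel. C / s * exp (- (s\<^sup>2 / 2 * \<theta>\<^sup>2)))"
    unfolding set_lebesgue_integral_def
  proof (rule Bochner_Integration.integral_norm_bound_integral)
    show "integrable lborel (\<lambda>\<theta>. C / s * exp (- (s\<^sup>2 / 2 * \<theta>\<^sup>2)))"
      using g by (intro integrable_mult_right) (simp add: has_bochner_integral_iff)
    show "norm (indicator {-pi..pi} \<theta> *\<^sub>R ((\<phi>' \<theta> - \<i> * of_real \<mu>) * E \<theta>))
        \<le> C / s * exp (- (s\<^sup>2 / 2 * \<theta>\<^sup>2))" for \<theta>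
      using pw[of \<theta>] C s by (cases "\<theta> \<in> {-pi..pi}") auto
  qed (use intE' in \<open>simp add: set_integrable_def\<close>)
  also have "\<dots> = C / s * sqrt (pi / (s\<^sup>2 / 2))" using g by (simp add: has_bochner_integral_iff)
  also have "sqrt (pi / (s\<^sup>2 / 2)) = sqrt (2 * pi) / s"
    using s(1) by (simp add: real_sqrt_divide mult.commute)
  \<comment> \<open>The Gaussian width gives a second \<open>1 / s\<close>. Since
    \<open>s\<^sup>2 = curv * t\<close>, this cancels the factor \<open>t\<close> and makes the
    bound uniform in \<open>t\<close>.\<close>
  also have "C / s * (sqrt (2 * pi) / s) = C * sqrt (2 * pi) / s\<^sup>2" by (simp add: power2_eq_square)
  finally have "t * norm (LINT \<theta>:{-pi..pi}|lborel. (\<phi>' \<theta> - \<i> * of_real \<mu>) * E \<theta>) \<le> t * (C * sqrt (2 * pi) / s\<^sup>2)"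
    using t by (intro mult_left_mono) auto
  also have "t * (C * sqrt (2 * pi) / s\<^sup>2) = C * sqrt (2 * pi) / curv" using t by (simp add: s)
  finally have le: "\<bar>real n - t * \<mu>\<bar> * norm J \<le> C * sqrt (2 * pi) / curv" using eq by simp
  have "norm (lattice_density \<phi> t (real n)) \<le> norm J"
    using pi_gt3 by (simp add: lattice_density_def J_def E_def norm_divide divide_le_eq mult_le_cancel_left1)
  then have "\<bar>real n - t * \<mu>\<bar> * norm (lattice_density \<phi> t (real n)) \<le> \<bar>real n - t * \<mu>\<bar> * norm J"
    by (rule mult_left_mono) simp
  then show ?thesis using le by linarith
qed

lemma borel_measurable_lattice_density [measurable]:
  "(\<lambda>t. lattice_density \<phi> t x) \<in> borel_measurable borel"
proof -
  \<comment> \<open>\<open>\<phi>\<close> is controlled only on the period, so it is cut off there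
    to obtain a globally measurable function before using joint measurability.\<close>
  define \<psi> where "\<psi> = (\<lambda>\<theta>. indicator {-pi..pi} \<theta> *\<^sub>R \<phi> \<theta>)"
  have [measurable]: "\<psi> \<in> borel_measurable borel" unfolding \<psi>_def
    by (rule borel_measurable_continuous_on_indicator[OF _ cont]) simp
  have "(\<lambda>(t, \<theta>). indicator {-pi..pi} \<theta> *\<^sub>R exp (of_real t * \<psi> \<theta> - \<i> * of_real (x * \<theta>)))
      \<in> borel_measurable (borel \<Otimes>\<^sub>M lborel)" by measurable
  then have "(\<lambda>t. LINT \<theta>|lborel. indicator {-pi..pi} \<theta> *\<^sub>R exp (of_real t * \<psi> \<theta> - \<i> * of_real (x * \<theta>)))
      \<in> borel_measurable borel"
    by (rule lborel.borel_measurable_lebesgue_integral)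
  moreover have "(LINT \<theta>|lborel. indicator {-pi..pi} \<theta> *\<^sub>R exp (of_real t * \<psi> \<theta> - \<i> * of_real (x * \<theta>))) /
      of_real (2 * pi) = lattice_density \<phi> t x" for t
    unfolding lattice_density_def set_lebesgue_integral_def
    by (intro arg_cong2[where f = "(/)"] Bochner_Integration.integral_cong refl)
       (auto simp: \<psi>_def indicator_def)
  ultimately show ?thesis by (simp flip: \<open>\<And>t. _ = lattice_density \<phi> t x\<close>)
qed

text \<open>After the substitution \<open>t = N / (q \<mu>) + sqrt N * s\<close>, the two bounds on the density, for small and for
  large \<open>s\<close>, give a majorant of order \<open>(1 + s\<^sup>2) powr (- q / 2)\<close>; it is integrable because \<open>q \<ge> 2\<close>.\<close>

theorem diagonal_integral_asymptotics:
  fixes n :: "nat \<Rightarrow> nat \<Rightarrow> nat" and N :: "nat \<Rightarrow> real" and q :: nat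
  assumes \<mu>: "\<mu> > 0" and q: "q \<ge> 2"
    and C: "\<And>t m. t > 0 \<Longrightarrow> \<bar>real m - t * \<mu>\<bar> * norm (lattice_density \<phi> t (real m)) \<le> C"
    and N: "filterlim N at_top sequentially"
    and B: "\<forall>\<^sub>F k in sequentially. \<forall>j\<in>{1..q}. \<bar>real (n k j) - N k / q\<bar> \<le> B"
  defines "w \<equiv> v / (q * \<mu>)"
  shows "(\<lambda>k. of_real (sqrt (N k) ^ (q - 1)) *
       (LINT t:{0<..}|lborel. \<Prod>j\<in>{1..q}. lattice_density \<phi> t (real (n k j)))) \<longlonglongrightarrow>
     complex_of_real ((1 / sqrt (2 * pi * w)) ^ q * (sqrt (2 * pi * w / q) / \<mu>))"
proof -
  define R where "R = (\<lambda>k. sqrt (N k))"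
  define D where "D = (\<lambda>k t j. lattice_density \<phi> t (real (n k j)))"
  define T where "T = (\<lambda>k s. N k / (q * \<mu>) + R k * s)"
  have R: "filterlim R at_top sequentially" unfolding R_def
    by (rule filterlim_compose[OF sqrt_at_top N])
  have w: "w > 0" using v \<mu> q by (simp add: w_def)
  define C1 where "C1 = sqrt (pi / curv)"
  define M1 where "M1 = C1 * sqrt (2 * (q * \<mu>))"
  \<comment> \<open>\<open>M1\<close> bounds the case of \<open>s\<close> in \<open>{-1..1}\<close>
    and \<open>(2 * C / \<mu>) / \<bar>s\<bar>\<close> the rest; the factor 2 pays for
    \<open>sqrt (1 + s\<^sup>2) \<le> 2 * max 1 \<bar>s\<bar>\<close>.\<close>
  define M where "M = 2 * max M1 (2 * C / \<mu>)"
  have M1: "M1 \<ge> 0" using curv_pos \<mu> by (simp add: M1_def C1_def)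
  then have M: "M \<ge> 0" by (simp add: M_def)
  \<comment> \<open>\<open>R k \<ge> 2 * (q * \<mu>)\<close> keeps \<open>T k s\<close> above half
    its centre when \<open>\<bar>s\<bar> \<le> 1\<close>; \<open>R k \<ge> 2 * B / \<mu>\<close>
    keeps the deviation \<open>B\<close> below half of \<open>R k * \<mu> * \<bar>s\<bar>\<close>
    when \<open>\<bar>s\<bar> > 1\<close>.\<close>
  have "eventually (\<lambda>k. R k > 0 \<and> R k \<ge> 2 * (q * \<mu>) \<and> R k \<ge> 2 * B / \<mu> \<and>
      (\<forall>j\<in>{1..q}. \<bar>real (n k j) - N k / q\<bar> \<le> B)) sequentially"
    using R[unfolded filterlim_at_top_dense, rule_format, of 0]
      R[unfolded filterlim_at_top, rule_format, of "2 * (q * \<mu>)"]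
      R[unfolded filterlim_at_top, rule_format, of "2 * B / \<mu>"] B
    by eventually_elim auto
  then obtain K where "\<forall>k\<ge>K. R k > 0 \<and> R k \<ge> 2 * (q * \<mu>) \<and> R k \<ge> 2 * B / \<mu> \<and>
      (\<forall>j\<in>{1..q}. \<bar>real (n k j) - N k / q\<bar> \<le> B)"
    unfolding eventually_sequentially by blast
  then have K: "R k > 0" "R k \<ge> 2 * (q * \<mu>)" "R k \<ge> 2 * B / \<mu>"
      "j \<in> {1..q} \<Longrightarrow> \<bar>real (n k j) - N k / q\<bar> \<le> B" if "k \<ge> K" for k j
    using that by blast+
  have N': "N k = (R k)\<^sup>2" if "k \<ge> K" for k
    using K(1)[OF that] by (simp add: R_def)
  have bound: "norm (of_real (R k) * D k (T k s) j) \<le> M / sqrt (1 + s\<^sup>2)"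
    if k: "k \<ge> K" and j: "j \<in> {1..q}" and pos: "T k s > 0" for k s j
  proof (cases "\<bar>s\<bar> \<le> 1")
    case True
    have "R k * s \<ge> - R k" using True K(1)[OF k] mult_left_mono[of "-1" s "R k"] by simp
    moreover have "R k \<le> N k / (2 * (q * \<mu>))"
      using K(1,2)[OF k] \<mu> q by (simp add: N'[OF k] field_simps power2_eq_square)
    ultimately have T: "T k s \<ge> N k / (2 * (q * \<mu>))" by (simp add: T_def field_simps)
    have "norm (D k (T k s) j) \<le> C1 / sqrt (T k s)"
      unfolding D_def C1_def by (rule norm_lattice_density_le[OF pos])
    also have "\<dots> \<le> C1 / sqrt (N k / (2 * (q * \<mu>)))"
      using T pos curv_pos N'[OF k] K(1)[OF k] \<mu> q
      by (intro divide_left_mono mult_pos_pos real_sqrt_le_mono) (auto simp: C1_def)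
    also have "\<dots> = M1 / R k" by (simp add: M1_def R_def real_sqrt_divide)
    finally have "R k * norm (D k (T k s) j) \<le> M1"
      using K(1)[OF k] by (simp add: field_simps)
    also have "M1 \<le> M / 2" by (simp add: M_def)
    also have "s\<^sup>2 \<le> 1" using True by (simp add: abs_square_le_1)
    then have "sqrt (1 + s\<^sup>2) \<le> 2" by (intro real_le_lsqrt) auto
    then have "M / 2 \<le> M / sqrt (1 + s\<^sup>2)"
      using M by (intro divide_left_mono mult_pos_pos) (auto simp: add_pos_nonneg)
    finally show ?thesis using K(1)[OF k] by (simp add: norm_mult)
  next
    case False
    define a where "a = \<bar>real (n k j) - T k s * \<mu>\<bar>"
    have "T k s * \<mu> = N k / q + R k * s * \<mu>" using \<mu> q by (simp add: T_def field_simps)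
    then have "a \<ge> \<bar>R k * s * \<mu>\<bar> - B" using K(4)[OF k j] by (simp add: a_def)
    also have "\<bar>R k * s * \<mu>\<bar> = R k * \<mu> * \<bar>s\<bar>" using K(1)[OF k] \<mu> by (simp add: abs_mult)
    finally have "a \<ge> R k * \<mu> * \<bar>s\<bar> - B" .
    moreover have "B \<le> R k * \<mu> * 1 / 2" using K(3)[OF k] \<mu> by (simp add: field_simps)
    moreover have "R k * \<mu> * 1 / 2 \<le> R k * \<mu> * \<bar>s\<bar> / 2" using False K(1)[OF k] \<mu>
      by (intro divide_right_mono mult_left_mono) auto
    ultimately have a: "a \<ge> R k * \<mu> * \<bar>s\<bar> / 2" by linarith
    have "R k * \<mu> * \<bar>s\<bar> / 2 * norm (D k (T k s) j) \<le> a * norm (D k (T k s) j)"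
      using a by (rule mult_right_mono) simp
    also have "\<dots> \<le> C" unfolding a_def D_def by (rule C[OF pos])
    finally have "R k * norm (D k (T k s) j) \<le> (2 * C / \<mu>) / \<bar>s\<bar>"
      using \<mu> False by (simp add: field_simps)
    also have "\<dots> \<le> (M / 2) / \<bar>s\<bar>" by (intro divide_right_mono) (auto simp: M_def)
    also have "\<dots> = M / (2 * \<bar>s\<bar>)" by simp
    also have "sqrt (1 + s\<^sup>2) \<le> 2 * \<bar>s\<bar>"
    proof (rule real_le_lsqrt)
      have "1 \<le> \<bar>s\<bar> ^ 2" using False by (intro one_le_power) simp
      then have "1 \<le> s\<^sup>2" by simp
      then show "1 + s\<^sup>2 \<le> (2 * \<bar>s\<bar>)\<^sup>2" by (simp add: power_mult_distrib)
    qed auto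
    then have "M / (2 * \<bar>s\<bar>) \<le> M / sqrt (1 + s\<^sup>2)"
      using M False by (intro divide_left_mono mult_pos_pos) (auto simp: add_pos_nonneg)
    finally show ?thesis using K(1)[OF k] by (simp add: norm_mult)
  qed
  define g where "g = (\<lambda>k s. indicator {0<..} (T k s) *\<^sub>R (\<Prod>j\<in>{1..q}. of_real (R k) * D k (T k s) j))"
  define G where "G = (\<lambda>s. complex_of_real ((1 / sqrt (2 * pi * w)) ^ q * exp (- (q * \<mu>\<^sup>2 / (2 * w) * s\<^sup>2))))"
  have resc: "of_real (sqrt (N k) ^ (q - 1)) *
       (LINT t:{0<..}|lborel. \<Prod>j\<in>{1..q}. lattice_density \<phi> t (real (n k j))) = (LINT s|lborel. g k s)"
    if k: "k \<ge> K" for k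
  proof -
    have "(LINT t|lborel. indicator {0<..} t *\<^sub>R (\<Prod>j\<in>{1..q}. D k t j)) =
       \<bar>R k\<bar> *\<^sub>R (LINT s|lborel. indicator {0<..} (T k s) *\<^sub>R (\<Prod>j\<in>{1..q}. D k (T k s) j))"
      unfolding T_def using K(1)[OF k] by (intro lborel_integral_real_affine) auto
    then have "of_real (R k ^ (q - 1)) * (LINT t:{0<..}|lborel. \<Prod>j\<in>{1..q}. D k t j) =
       of_real (R k ^ (q - 1) * R k) * (LINT s|lborel. indicator {0<..} (T k s) *\<^sub>R (\<Prod>j\<in>{1..q}. D k (T k s) j))"
      using K(1)[OF k] by (simp add: set_lebesgue_integral_def scaleR_conv_of_real)
    \<comment> \<open>The Jacobian of the substitution supplies the last of the \<open>q\<close>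
      scaling factors, one for each density.\<close>
    also have "R k ^ (q - 1) * R k = R k ^ q" using q by (simp flip: power_Suc2)
    also have "of_real (R k ^ q) * (LINT s|lborel. indicator {0<..} (T k s) *\<^sub>R (\<Prod>j\<in>{1..q}. D k (T k s) j)) =
       (LINT s|lborel. of_real (R k ^ q) * (indicator {0<..} (T k s) *\<^sub>R (\<Prod>j\<in>{1..q}. D k (T k s) j)))"
      by (rule integral_mult_right_zero[symmetric])
    also have "\<dots> = (LINT s|lborel. g k s)"
      by (intro Bochner_Integration.integral_cong refl) (simp add: g_def prod.distrib)
    finally show ?thesis by (simp add: R_def D_def)
  qed
  have meas: "g k \<in> borel_measurable lborel" for k
    unfolding g_def D_def T_def by measurable
  have dom: "norm (g k s) \<le> M ^ q * inverse (1 + s\<^sup>2)" if k: "k \<ge> K" for k s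
  proof (cases "T k s > 0")
    case True
    have s: "1 \<le> sqrt (1 + s\<^sup>2)" by simp
    have "norm (g k s) = (\<Prod>j\<in>{1..q}. norm (of_real (R k) * D k (T k s) j))"
      using True by (simp add: g_def prod_norm)
    also have "\<dots> \<le> (\<Prod>j\<in>{1..q}. M / sqrt (1 + s\<^sup>2))"
      by (intro prod_mono conjI norm_ge_zero bound k True)
    also have "\<dots> = M ^ q / sqrt (1 + s\<^sup>2) ^ q" by (simp add: power_divide)
    also have "\<dots> \<le> M ^ q / sqrt (1 + s\<^sup>2) ^ 2"
      using s q M
      by (intro divide_left_mono power_increasing mult_pos_pos zero_less_power zero_le_power)
         (auto simp: add_pos_nonneg)
    also have "\<dots> = M ^ q * inverse (1 + s\<^sup>2)" by (simp add: divide_inverse)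
    finally show ?thesis .
  next
    case False
    then show ?thesis using M by (simp add: g_def)
  qed
  have lim_g: "(\<lambda>k. g k s) \<longlonglongrightarrow> G s" for s
  proof -
    have Ts: "eventually (\<lambda>k. T k s / (R k)\<^sup>2 = 1 / (q * \<mu>) + s / R k) sequentially"
      using eventually_ge_at_top[of K]
    proof eventually_elim
      case (elim k)
      then show ?case using K(1)[of k] \<mu> q N'[of k]
        by (simp add: T_def field_simps power2_eq_square)
    qed
    have s0: "(\<lambda>k. c / R k) \<longlonglongrightarrow> 0" for c
      by (rule tendsto_divide_0[OF tendsto_const filterlim_at_top_imp_at_infinity[OF R]])
    have "(\<lambda>k. 1 / (q * \<mu>) + s / R k) \<longlonglongrightarrow> 1 / (q * \<mu>) + 0"
      by (intro tendsto_add tendsto_const s0)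
    then have \<tau>: "(\<lambda>k. T k s / (R k)\<^sup>2) \<longlonglongrightarrow> 1 / (q * \<mu>)"
      using tendsto_cong[OF Ts] by simp
    then have "eventually (\<lambda>k. T k s / (R k)\<^sup>2 > 0) sequentially"
      using \<mu> q by (intro order_tendstoD(1)[OF \<tau>]) simp
    then have pos: "eventually (\<lambda>k. T k s > 0) sequentially"
      by eventually_elim (metis divide_nonpos_nonneg not_less zero_le_power2)
    have "(\<lambda>k. of_real (R k) * D k (T k s) j) \<longlonglongrightarrow>
        of_real (exp (- (s * \<mu>)\<^sup>2 / (2 * (1 / (q * \<mu>) * v))) / sqrt (2 * pi * (1 / (q * \<mu>) * v)))"
      if j: "j \<in> {1..q}" for j
      unfolding D_def
    proof (rule lattice_density_tendsto[OF R \<tau>])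
      show "0 < 1 / (real q * \<mu>)" using \<mu> q by simp
      \<comment> \<open>A bounded deviation is invisible on the scale \<open>R k\<close>, so every
        factor has the same offset \<open>s * \<mu>\<close> from its peak.\<close>
      have "(\<lambda>k. (N k / q - real (n k j)) / R k) \<longlonglongrightarrow> 0"
      proof (rule Lim_null_comparison)
        show "\<forall>\<^sub>F k in sequentially. norm ((N k / q - real (n k j)) / R k) \<le> B / R k"
          using eventually_ge_at_top[of K]
        proof eventually_elim
          case (elim k)
          then show ?case using K(1)[of k] K(4)[of k j] j
            by (auto simp: abs_divide abs_minus_commute intro!: divide_right_mono)
        qed
      qed (rule s0)
      then have "(\<lambda>k. (N k / q - real (n k j)) / R k + s * \<mu>) \<longlonglongrightarrow> 0 + s * \<mu>"
        by (intro tendsto_add tendsto_const)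
      moreover have "eventually (\<lambda>k. (N k / q - real (n k j)) / R k + s * \<mu> = (T k s * \<mu> - real (n k j)) / R k) sequentially"
        using eventually_ge_at_top[of K]
      proof eventually_elim
        case (elim k)
        then show ?case using K(1)[of k] \<mu> q by (simp add: T_def field_simps)
      qed
      ultimately have "(\<lambda>k. (T k s * \<mu> - real (n k j)) / R k) \<longlonglongrightarrow> 0 + s * \<mu>"
        by (rule Lim_transform_eventually)
      then show "(\<lambda>k. (T k s * \<mu> - real (n k j)) / R k) \<longlonglongrightarrow> s * \<mu>" by simp
    qed
    then have "(\<lambda>k. \<Prod>j\<in>{1..q}. of_real (R k) * D k (T k s) j) \<longlonglongrightarrow>
        (\<Prod>j\<in>{1..q}. of_real (exp (- (s * \<mu>)\<^sup>2 / (2 * (1 / (q * \<mu>) * v))) / sqrt (2 * pi * (1 / (q * \<mu>) * v))))"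
      by (rule tendsto_prod)
    also have "1 / (q * \<mu>) * v = w" by (simp add: w_def)
    also have "(\<Prod>j\<in>{1..q}. complex_of_real (exp (- (s * \<mu>)\<^sup>2 / (2 * w)) / sqrt (2 * pi * w))) = G s"
      by (simp add: G_def power_divide exp_of_nat_mult[symmetric] power_mult_distrib flip: of_real_power)
    finally show ?thesis
    proof (rule Lim_transform_eventually)
      show "\<forall>\<^sub>F k in sequentially. (\<Prod>j\<in>{1..q}. of_real (R k) * D k (T k s) j) = g k s"
        using pos by eventually_elim (simp add: g_def)
    qed
  qed
  have "has_bochner_integral lborel (\<lambda>s. exp (- (q * \<mu>\<^sup>2 / (2 * w) * s\<^sup>2))) (sqrt (pi / (q * \<mu>\<^sup>2 / (2 * w))))"
    using w q \<mu> by (intro has_bochner_integral_gaussian) auto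
  also have "pi / (q * \<mu>\<^sup>2 / (2 * w)) = (2 * pi * w / q) / \<mu>\<^sup>2" by simp
  also have "sqrt \<dots> = sqrt (2 * pi * w / q) / \<mu>" using \<mu> by (subst real_sqrt_divide) simp
  finally have G: "has_bochner_integral lborel G
      (complex_of_real ((1 / sqrt (2 * pi * w)) ^ q * (sqrt (2 * pi * w / q) / \<mu>)))"
    unfolding G_def by (intro has_bochner_integral_of_real has_bochner_integral_mult_right)
  have "(\<lambda>k. LINT s|lborel. g (k + K) s) \<longlonglongrightarrow> (LINT s|lborel. G s)"
  proof (rule integral_dominated_convergence)
    have "integrable lborel (\<lambda>s :: real. inverse (1 + s\<^sup>2))"
      using integrable_inverse_1_plus_square by (simp add: set_integrable_def)
    then show "integrable lborel (\<lambda>s :: real. M ^ q * inverse (1 + s\<^sup>2))"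
      by (rule integrable_mult_right)
    show "AE s in lborel. (\<lambda>k. g (k + K) s) \<longlonglongrightarrow> G s"
      using LIMSEQ_ignore_initial_segment[OF lim_g] by auto
    show "G \<in> borel_measurable lborel" using G by (auto simp: has_bochner_integral_iff)
  qed (use meas dom in auto)
  then have "(\<lambda>k. LINT s|lborel. g k s) \<longlonglongrightarrow> (LINT s|lborel. G s)" by (rule LIMSEQ_offset)
  then have "(\<lambda>k. LINT s|lborel. g k s) \<longlonglongrightarrow>
      complex_of_real ((1 / sqrt (2 * pi * w)) ^ q * (sqrt (2 * pi * w / q) / \<mu>))"
    using G by (simp only: has_bochner_integral_iff)
  then show ?thesis
  proof (rule Lim_transform_eventually)
    show "\<forall>\<^sub>F k in sequentially. (LINT s|lborel. g k s) = of_real (sqrt (N k) ^ (q - 1)) *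
       (LINT t:{0<..}|lborel. \<Prod>j\<in>{1..q}. lattice_density \<phi> t (real (n k j)))"
      using eventually_ge_at_top[of K] by eventually_elim (rule resc[symmetric])
  qed
qed

end

section \<open>The Poisson exponent and the exponent of a part\<close>

text \<open>Logarithm of the characteristic function of the Poisson law with mean 1.\<close>

definition poisson_exponent :: "real \<Rightarrow> complex" where
  "poisson_exponent \<theta> = exp (\<i> * of_real \<theta>) - 1"

text \<open>The function \<open>1 - exp (-z)\<close> at \<open>z = L * exp (\<i> * \<theta>)\<close>
  minus its value at \<open>z = L\<close>, so that the exponent vanishes at
  \<open>\<theta> = 0\<close>.\<close>

definition part_exponent :: "real \<Rightarrow> real \<Rightarrow> complex" where
  "part_exponent L \<theta> = of_real (exp (- L)) - exp (- (of_real L * exp (\<i> * of_real \<theta>)))"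

lemma lattice_exponent_poisson: "lattice_exponent poisson_exponent 1 1"
proof
  show "continuous_on {-pi..pi} poisson_exponent" unfolding poisson_exponent_def
    by (intro continuous_intros)
  show "poisson_exponent 0 = 0" by (simp add: poisson_exponent_def)
  fix \<theta> :: real assume \<theta>: "\<theta> \<in> {-pi..pi}" "\<theta> \<noteq> 0"
  have "cos \<bar>\<theta>\<bar> < cos 0" using \<theta> by (intro cos_monotone_0_pi) auto
  then show "Re (poisson_exponent \<theta>) < 0" by (simp add: poisson_exponent_def Re_exp)
next
  have "((\<lambda>\<theta> :: real. (exp (\<i> * of_real \<theta>) - 1 - \<i> * exp (\<i> * 0) * of_real \<theta>) / of_real (\<theta>\<^sup>2)) \<longlongrightarrow>
      (- exp (\<i> * 0)) / 2) (at 0)"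
    by (rule tendsto_second_order_quotient) (auto intro!: derivative_eq_intros simp: algebra_simps)
  then show "((\<lambda>\<theta>. (poisson_exponent \<theta> - \<i> * of_real 1 * of_real \<theta>) / of_real (\<theta>\<^sup>2)) \<longlongrightarrow> - of_real 1 / 2) (at 0)"
    by (simp add: poisson_exponent_def)
qed simp

lemma lattice_density_poisson:
  "lattice_density poisson_exponent t (real n) = of_real (exp (- t) * t ^ n / fact n)"
proof -
  have "(LINT \<theta>:{-pi..pi}|lborel. exp (of_real t * (of_real 1 * exp (\<i> * of_real \<theta>))) *
            exp (- \<i> * of_real (real n * \<theta>))) = of_real (2 * pi * 1 ^ n) * fps_nth (fps_exp (of_real t)) n"
    by (rule fps_nth_circle_integral) (auto intro!: holomorphic_intros fps_expansion_intros)
  also have "(\<lambda>\<theta>. exp (of_real t * (of_real 1 * exp (\<i> * of_real \<theta>))) * exp (- \<i> * of_real (real n * \<theta>))) =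
     (\<lambda>\<theta>. of_real (exp t) * exp (of_real t * poisson_exponent \<theta> - \<i> * of_real (real n * \<theta>)))"
    unfolding exp_of_real[symmetric] mult_exp_exp by (simp add: poisson_exponent_def algebra_simps)
  finally show ?thesis
    by (simp add: lattice_density_def exp_minus field_simps)
qed

context
  fixes L :: real
  assumes L: "0 < L" "L < 1"
begin

text \<open>The right side is the real part of \<open>exp (- L * exp (\<i> * \<theta>))\<close>,
  even in \<open>\<theta>\<close>. On \<open>(0, pi)\<close> its derivative is a positive multiple
  of \<open>sin (x - L * sin x)\<close>, and \<open>L < 1\<close> places that argument in
  \<open>(0, pi)\<close>.\<close>

lemma exp_neg_less_part_real:
  assumes \<theta>: "\<theta> \<in> {-pi..pi}" "\<theta> \<noteq> 0"
  shows "exp (- L) < exp (- (L * cos \<theta>)) * cos (L * sin \<theta>)"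
proof -
  define h where "h = (\<lambda>\<theta>. exp (- (L * cos \<theta>)) * cos (L * sin \<theta>))"
  have "h 0 < h \<bar>\<theta>\<bar>"
  proof (rule DERIV_pos_imp_increasing_open[where f = h])
    show "continuous_on {0..\<bar>\<theta>\<bar>} h" unfolding h_def by (intro continuous_intros)
    fix x assume x: "0 < x" "x < \<bar>\<theta>\<bar>"
    then have xpi: "x < pi" using \<theta> by auto
    have "(h has_real_derivative L * exp (- (L * cos x)) * sin (x - L * sin x)) (at x)"
      unfolding h_def sin_diff
      by (auto intro!: derivative_eq_intros simp: algebra_simps)
    moreover have "sin (x - L * sin x) > 0"
    proof (rule sin_gt_zero)
      have "sin x > 0" using x xpi by (intro sin_gt_zero)
      then have "L * sin x < sin x" "L * sin x > 0" using L by auto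
      moreover have "sin x \<le> x" using x by (intro sin_x_le_x) auto
      ultimately show "0 < x - L * sin x" "x - L * sin x < pi" using xpi by auto
    qed
    ultimately show "\<exists>y. (h has_real_derivative y) (at x) \<and> y > 0"
      using L by (intro exI[of _ "L * exp (- (L * cos x)) * sin (x - L * sin x)"]) simp
  qed (use \<theta> in auto)
  moreover have "h \<bar>\<theta>\<bar> = h \<theta>" by (auto simp: h_def abs_if)
  ultimately show ?thesis by (simp add: h_def)
qed

text \<open>Mean and variance are read off the first two derivatives at 0; \<open>L < 1\<close>
  makes the variance positive.\<close>

lemma lattice_exponent_part:
  "lattice_exponent (part_exponent L) (L * exp (- L)) (L * (1 - L) * exp (- L))"
proof
  show "continuous_on {-pi..pi} (part_exponent L)" unfolding part_exponent_def
    by (intro continuous_intros)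
  show "part_exponent L 0 = 0" by (simp add: part_exponent_def flip: exp_of_real)
  fix \<theta> :: real assume "\<theta> \<in> {-pi..pi}" "\<theta> \<noteq> 0"
  then show "Re (part_exponent L \<theta>) < 0"
    using exp_neg_less_part_real by (simp add: part_exponent_def Re_exp Im_exp)
next
  show "L * (1 - L) * exp (- L) > 0" using L by simp
  define F where "F = (\<lambda>z. exp (- of_real L) - exp (- (of_real L * exp (\<i> * z))))"
  define F1 where "F1 = (\<lambda>z. \<i> * of_real L * exp (\<i> * z) * exp (- (of_real L * exp (\<i> * z))))"
  define F2 where "F2 = (\<lambda>z. - (of_real L * exp (\<i> * z) * (1 - of_real L * exp (\<i> * z)) *
     exp (- (of_real L * exp (\<i> * z)))))"
  have "((\<lambda>\<theta> :: real. (F (of_real \<theta>) - F1 0 * of_real \<theta>) / of_real (\<theta>\<^sup>2)) \<longlongrightarrow> F2 0 / 2) (at 0)"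
  proof (rule tendsto_second_order_quotient)
    show "(F has_field_derivative F1 z) (at z)" for z unfolding F_def F1_def
      by (auto intro!: derivative_eq_intros)
    show "(F1 has_field_derivative F2 z) (at z)" for z unfolding F1_def F2_def
      by (auto intro!: derivative_eq_intros simp: algebra_simps)
    have "of_real L \<noteq> (1 :: complex)" using L by (metis less_irrefl of_real_1 of_real_eq_iff)
    then show "F2 0 \<noteq> 0" using L by (simp add: F2_def)
  qed (simp add: F_def)
  moreover have "F1 0 = \<i> * of_real (L * exp (- L))" by (simp add: F1_def flip: exp_of_real)
  moreover have "F2 0 = - of_real (L * (1 - L) * exp (- L))"
    by (simp add: F2_def flip: exp_of_real)
  moreover have "F (of_real \<theta>) = part_exponent L \<theta>" for \<theta>
    by (simp add: F_def part_exponent_def flip: exp_of_real)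
  ultimately show "((\<lambda>\<theta>. (part_exponent L \<theta> - \<i> * of_real (L * exp (- L)) * of_real \<theta>) / of_real (\<theta>\<^sup>2))
      \<longlongrightarrow> - of_real (L * (1 - L) * exp (- L)) / 2) (at 0)"
    by simp
qed

lemma part_density_bound:
  "\<exists>C. \<forall>t>0. \<forall>n. \<bar>real n - t * (L * exp (- L))\<bar> *
     norm (lattice_density (part_exponent L) t (real n)) \<le> C"
proof -
  interpret lattice_exponent "part_exponent L" "L * exp (- L)" "L * (1 - L) * exp (- L)"
    by (rule lattice_exponent_part)
  define \<phi>1 where "\<phi>1 = (\<lambda>\<theta> :: real. \<i> * of_real L * exp (\<i> * of_real \<theta>) * exp (- (of_real L * exp (\<i> * of_real \<theta>))))"
  define \<phi>2 where "\<phi>2 = (\<lambda>\<theta> :: real. - (of_real L * exp (\<i> * of_real \<theta>) * (1 - of_real L * exp (\<i> * of_real \<theta>)) *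
     exp (- (of_real L * exp (\<i> * of_real \<theta>)))))"
  have d1: "(part_exponent L has_vector_derivative \<phi>1 \<theta>) (at \<theta>)" for \<theta>
  proof -
    have "((\<lambda>z. of_real (exp (- L)) - exp (- (of_real L * exp (\<i> * z)))) has_field_derivative \<phi>1 \<theta>) (at (of_real \<theta>))"
      unfolding \<phi>1_def by (auto intro!: derivative_eq_intros)
    then show ?thesis unfolding part_exponent_def by (rule has_vector_derivative_real_field)
  qed
  have d2: "(\<phi>1 has_vector_derivative \<phi>2 \<theta>) (at \<theta> within A)" for \<theta> A
  proof -
    have "((\<lambda>z. \<i> * of_real L * exp (\<i> * z) * exp (- (of_real L * exp (\<i> * z)))) has_field_derivative \<phi>2 \<theta>) (at (of_real \<theta>))"
      unfolding \<phi>2_def by (auto intro!: derivative_eq_intros simp: algebra_simps)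
    then show ?thesis unfolding \<phi>1_def by (rule has_vector_derivative_real_field)
  qed
  have "continuous_on {-pi..pi} \<phi>2" unfolding \<phi>2_def by (intro continuous_intros)
  then have "bounded (\<phi>2 ` {-pi..pi})" by (intro compact_imp_bounded compact_continuous_image) auto
  then obtain B where B: "\<And>\<theta>. \<theta> \<in> {-pi..pi} \<Longrightarrow> norm (\<phi>2 \<theta>) \<le> B" unfolding bounded_iff by blast
  \<comment> \<open>The mean value inequality between 0 and \<open>\<theta>\<close>, since
    \<open>\<phi>1 0\<close> is \<open>\<i>\<close> times the mean.\<close>
  have lip: "norm (\<phi>1 \<theta> - \<i> * of_real (L * exp (- L))) \<le> B * \<bar>\<theta>\<bar>" if "\<theta> \<in> {-pi..pi}" for \<theta>
  proof -
    have "norm (\<phi>1 \<theta> - \<phi>1 0) \<le> B * norm (\<theta> - 0)"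
      by (rule differentiable_bound[of "{-pi..pi}" \<phi>1 "\<lambda>x h. h *\<^sub>R \<phi>2 x"])
         (use d2 B that in \<open>auto simp: has_vector_derivative_def onorm_scaleR_left onorm_id\<close>)
    then show ?thesis by (simp add: \<phi>1_def mult.assoc flip: exp_of_real)
  qed
  show ?thesis
  proof (intro exI allI impI)
    fix t :: real and n :: nat assume "t > 0"
    show "\<bar>real n - t * (L * exp (- L))\<bar> * norm (lattice_density (part_exponent L) t (real n)) \<le> B * sqrt (2 * pi) / curv"
    proof (rule norm_lattice_density_le_inverse[OF d1 _ _ lip \<open>t > 0\<close>])
      show "continuous_on {-pi..pi} \<phi>1" unfolding \<phi>1_def by (intro continuous_intros)
      have "exp (- (\<i> * of_real pi)) = exp (\<i> * of_real pi)" by (simp add: exp_minus)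
      then show "part_exponent L (- pi) = part_exponent L pi" by (simp add: part_exponent_def)
    qed
  qed
qed

text \<open>Cauchy's formula on the circle of radius \<open>L\<close>; the value of
  \<open>exp (t * (1 - exp (-z)))\<close> at \<open>z = L\<close> is pulled out, leaving the
  normalised density.\<close>

lemma poly_part_poly_density:
  "poly (part_poly n) (of_real t) =
     of_real (fact n / L ^ n * exp (t * (1 - exp (- L)))) * lattice_density (part_exponent L) t (real n)"
proof -
  define f where "f = (\<lambda>z. exp (of_real t * (1 - exp (- z))) :: complex)"
  have "(\<lambda>z. exp (of_real t * z)) has_fps_expansion fps_exp (of_real t :: complex)"
    by (rule fps_expansion_intros)
  moreover have "(\<lambda>z :: complex. 1 - exp (- z)) has_fps_expansion part_fps"
    unfolding part_fps_def by (intro fps_expansion_intros)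
  ultimately have exps: "f has_fps_expansion (fps_exp (of_real t) oo part_fps)"
    unfolding f_def using has_fps_expansion_compose by (fastforce simp: o_def part_fps_nth)
  have "(LINT \<theta>:{-pi..pi}|lborel. f (of_real L * exp (\<i> * of_real \<theta>)) *
            exp (- \<i> * of_real (real n * \<theta>))) = of_real (2 * pi * L ^ n) * fps_nth (fps_exp (of_real t) oo part_fps) n"
    by (rule fps_nth_circle_integral[OF _ exps L(1)]) (auto simp: f_def intro!: holomorphic_intros)
  also have "(\<lambda>\<theta>. f (of_real L * exp (\<i> * of_real \<theta>)) * exp (- \<i> * of_real (real n * \<theta>))) =
     (\<lambda>\<theta>. of_real (exp (t * (1 - exp (- L)))) * exp (of_real t * part_exponent L \<theta> - \<i> * of_real (real n * \<theta>)))"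
    unfolding exp_of_real[symmetric] mult_exp_exp f_def by (simp add: part_exponent_def algebra_simps)
  finally have "of_real (exp (t * (1 - exp (- L)))) * (of_real (2 * pi) * lattice_density (part_exponent L) t (real n)) =
      of_real (2 * pi * L ^ n) * fps_nth (fps_exp (of_real t) oo part_fps) n"
    by (simp add: lattice_density_def)
  then have "fps_nth (fps_exp (of_real t) oo part_fps) n =
      of_real (exp (t * (1 - exp (- L))) / L ^ n) * lattice_density (part_exponent L) t (real n)"
    using L by (simp add: field_simps)
  then show ?thesis by (simp add: poly_part_poly)
qed

end

section \<open>Asymptotics\<close>

lemma Lq_bounds:
  assumes "q \<ge> 2"
  shows "0 < Lq q" "Lq q < 1" "exp (- Lq q) = (real q - 1) / real q"
proof -
  define x where "x = real q / (real q - 1)"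
  have x: "x > 1" "x \<le> 2" using assms by (auto simp: x_def field_simps)
  show "0 < Lq q" using x by (simp add: Lq_def x_def[symmetric])
  \<comment> \<open>Strictness matters for \<open>q = 2\<close>, where \<open>x - 1\<close> is
    exactly 1.\<close>
  have "ln x \<le> x - 1" "ln x \<noteq> x - 1"
    using x ln_le_minus_one[of x] ln_eq_minus_one[of x] by auto
  then show "Lq q < 1" using x by (simp add: Lq_def x_def[symmetric])
  show "exp (- Lq q) = (real q - 1) / real q"
    using assms x by (simp add: Lq_def exp_minus x_def)
qed

lemma AO_complete_multipartite_integral:
  assumes q: "q \<ge> 2"
    and W: "disjoint_family_on W {1..q}" "\<And>j. j \<in> {1..q} \<Longrightarrow> finite (W j)"
  shows "of_nat (AO (complete_multipartite q W)) =
     of_real ((\<Prod>j\<in>{1..q}. fact (card (W j))) / Lq q ^ (\<Sum>j\<in>{1..q}. card (W j))) *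
     (LINT t:{0<..}|lborel. \<Prod>j\<in>{1..q}. lattice_density (part_exponent (Lq q)) t (real (card (W j))))"
proof -
  define L where "L = Lq q"
  define D where "D = (\<lambda>t j. lattice_density (part_exponent L) t (real (card (W j))))"
  define P where "P = (\<Prod>j\<in>{1..q}. part_poly (card (W j)))"
  define c where "c = (\<Prod>j\<in>{1..q}. fact (card (W j))) / L ^ (\<Sum>j\<in>{1..q}. card (W j))"
  have L: "0 < L" "L < 1" "1 - exp (- L) = 1 / real q"
    using Lq_bounds[OF q] q by (auto simp: L_def field_simps)
  interpret lattice_exponent "part_exponent L" "L * exp (- L)" "L * (1 - L) * exp (- L)"
    by (rule lattice_exponent_part[OF L(1,2)])
  have poly: "of_real (exp (- t)) * poly P (of_real t) = of_real c * (\<Prod>j\<in>{1..q}. D t j)" for t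
  proof -
    have "poly P (of_real t) = (\<Prod>j\<in>{1..q}. of_real (fact (card (W j)) / L ^ card (W j) * exp (t / q)) * D t j)"
      unfolding P_def poly_prod poly_part_poly_density[OF L(1,2)] L(3) D_def by simp
    also have "\<dots> = of_real (\<Prod>j\<in>{1..q}. fact (card (W j)) / L ^ card (W j) * exp (t / q)) * (\<Prod>j\<in>{1..q}. D t j)"
      by (subst prod.distrib) (simp only: of_real_prod)
    also have "(\<Prod>j\<in>{1..q}. fact (card (W j)) / L ^ card (W j) * exp (t / q)) = c * exp (t / q) ^ q"
      by (simp add: prod.distrib prod_dividef c_def power_sum)
    also have "exp (t / q) ^ q = exp t" using q by (simp flip: exp_of_nat_mult)
    finally have "of_real (exp (- t)) * poly P (of_real t) =
        of_real (exp (- t) * (c * exp t)) * (\<Prod>j\<in>{1..q}. D t j)" by (simp add: mult.assoc)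
    also have "exp (- t) * (c * exp t) = c" by (simp add: exp_minus field_simps)
    finally show ?thesis .
  qed
  have [measurable]: "(\<lambda>t. D t j) \<in> borel_measurable borel" for j unfolding D_def by measurable
  have "of_nat (AO (complete_multipartite q W)) = factorial_functional P"
    unfolding P_def by (rule AO_complete_multipartite_functional[OF W])
  also have "\<dots> = (LINT t|lborel. indicator {0..} t *\<^sub>R (of_real (exp (- t)) * poly P (of_real t)))"
    by (rule has_bochner_integral_integral_eq[OF has_bochner_integral_factorial_functional, symmetric])
  also have "\<dots> = (LINT t|lborel. of_real c * (indicator {0<..} t *\<^sub>R (\<Prod>j\<in>{1..q}. D t j)))"
  \<comment> \<open>The null point 0 is dropped because the density estimates hold for
    \<open>t > 0\<close> only.\<close>
  proof (rule integral_cong_AE)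
    show "AE t in lborel. indicator {0..} t *\<^sub>R (of_real (exp (- t)) * poly P (of_real t)) =
        of_real c * (indicator {0<..} t *\<^sub>R (\<Prod>j\<in>{1..q}. D t j))"
      using AE_lborel_singleton[of "0 :: real"] unfolding poly
      by eventually_elim (auto simp: indicator_def)
  qed (unfold poly, measurable)
  also have "\<dots> = of_real c * (LINT t:{0<..}|lborel. \<Prod>j\<in>{1..q}. D t j)"
    unfolding set_lebesgue_integral_def by (rule integral_mult_right_zero)
  finally show ?thesis unfolding c_def D_def L_def .
qed

text \<open>The multinomial probability is the product of \<open>q\<close> Poisson weights of mean
  \<open>N/q\<close> at the \<open>n k j\<close>, divided by the Poisson weight of mean
  \<open>N\<close> at \<open>N\<close>; exponentials and powers of \<open>N\<close> cancel because
  the \<open>n k j\<close> sum to \<open>N\<close>.\<close>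

lemma fact_multinomial_asymptotics:
  fixes n :: "nat \<Rightarrow> nat \<Rightarrow> nat" and N :: "nat \<Rightarrow> nat"
  assumes q: "q \<ge> 1" and N: "filterlim N at_top sequentially"
    and sum: "\<And>k. N k = (\<Sum>j\<in>{1..q}. n k j)"
    and B: "\<forall>\<^sub>F k in sequentially. \<forall>j\<in>{1..q}. \<bar>real (n k j) - N k / q\<bar> \<le> B"
  shows "(\<lambda>k. sqrt (N k) ^ (q - 1) * (fact (N k) / (real q ^ N k * (\<Prod>j\<in>{1..q}. fact (n k j)))))
     \<longlonglongrightarrow> (1 / sqrt (2 * pi / q)) ^ q * sqrt (2 * pi)"
proof -
  interpret lattice_exponent poisson_exponent 1 1 by (rule lattice_exponent_poisson)
  define R where "R = (\<lambda>k. sqrt (N k))"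
  have N': "filterlim (\<lambda>k. real (N k)) at_top sequentially"
    by (rule filterlim_compose[OF filterlim_real_sequentially N])
  have R: "filterlim R at_top sequentially" unfolding R_def
    by (rule filterlim_compose[OF sqrt_at_top N'])
  have pos: "eventually (\<lambda>k. N k > 0) sequentially"
    by (rule eventually_compose_filterlim[OF eventually_gt_at_top N])
  \<comment> \<open>Covers numerator (\<open>p = q\<close>) and denominator (\<open>p = 1\<close>):
    targets within bounded distance of the mean have limiting offset 0.\<close>
  have poisson: "(\<lambda>k. R k * (exp (- (N k / p)) * (N k / p) ^ m k / fact (m k))) \<longlonglongrightarrow> 1 / sqrt (2 * pi / p)"
    if p: "p > 0" and m: "eventually (\<lambda>k. \<bar>real (m k) - N k / p\<bar> \<le> B) sequentially" for p :: real and m B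
  proof -
    have "(\<lambda>k. of_real (R k) * lattice_density poisson_exponent (N k / p) (real (m k))) \<longlonglongrightarrow>
       of_real (exp (- 0\<^sup>2 / (2 * (1 / p * 1))) / sqrt (2 * pi * (1 / p * 1)))"
    proof (rule lattice_density_tendsto[OF R])
      show "(\<lambda>k. N k / p / (R k)\<^sup>2) \<longlonglongrightarrow> 1 / p"
        by (rule tendsto_eventually, use pos in eventually_elim) (simp add: R_def)
      show "(\<lambda>k. (N k / p * 1 - real (m k)) / R k) \<longlonglongrightarrow> 0"
      proof (rule Lim_null_comparison)
        show "\<forall>\<^sub>F k in sequentially. norm ((N k / p * 1 - real (m k)) / R k) \<le> B / R k"
          using m pos by eventually_elim (auto simp: R_def abs_divide abs_minus_commute intro!: divide_right_mono)
        show "(\<lambda>k. B / R k) \<longlonglongrightarrow> 0"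
          by (rule tendsto_divide_0[OF tendsto_const filterlim_at_top_imp_at_infinity[OF R]])
      qed
    qed (use p in simp)
    then have "(\<lambda>k. complex_of_real (R k * (exp (- (N k / p)) * (N k / p) ^ m k / fact (m k)))) \<longlonglongrightarrow>
       of_real (1 / sqrt (2 * pi / p))"
      unfolding lattice_density_poisson of_real_mult[symmetric] by simp
    then show ?thesis unfolding tendsto_of_real_iff .
  qed
  have "(\<lambda>k. (\<Prod>j\<in>{1..q}. R k * (exp (- (N k / q)) * (N k / q) ^ n k j / fact (n k j))) /
       (R k * (exp (- (N k / 1)) * (N k / 1) ^ N k / fact (N k)))) \<longlonglongrightarrow>
     (\<Prod>j\<in>{1..q}. 1 / sqrt (2 * pi / q)) / (1 / sqrt (2 * pi / 1))"
  proof (intro tendsto_divide tendsto_prod poisson)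
    show "\<forall>\<^sub>F k in sequentially. \<bar>real (n k j) - N k / q\<bar> \<le> B" if "j \<in> {1..q}" for j
      using B by eventually_elim (use that in auto)
    show "\<forall>\<^sub>F k in sequentially. \<bar>real (N k) - N k / 1\<bar> \<le> 0" by simp
  qed (use q in auto)
  also have "(\<Prod>j\<in>{1..q}. 1 / sqrt (2 * pi / q)) / (1 / sqrt (2 * pi / 1)) =
     (1 / sqrt (2 * pi / q)) ^ q * sqrt (2 * pi)" by simp
  finally show ?thesis
  proof (rule Lim_transform_eventually)
    show "\<forall>\<^sub>F k in sequentially.
       (\<Prod>j\<in>{1..q}. R k * (exp (- (N k / q)) * (N k / q) ^ n k j / fact (n k j))) /
       (R k * (exp (- (N k / 1)) * (N k / 1) ^ N k / fact (N k))) =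
       sqrt (N k) ^ (q - 1) * (fact (N k) / (real q ^ N k * (\<Prod>j\<in>{1..q}. fact (n k j))))"
      using pos
    proof eventually_elim
      case (elim k)
      have Rk: "R k > 0" using elim by (simp add: R_def)
      have "(\<Prod>j\<in>{1..q}. R k * (exp (- (N k / q)) * (N k / q) ^ n k j / fact (n k j))) =
          R k ^ q * (exp (- (N k / q)) ^ q * (N k / q) ^ N k / (\<Prod>j\<in>{1..q}. fact (n k j)))"
        by (simp add: prod.distrib prod_dividef sum power_sum)
      also have "exp (- (N k / q)) ^ q = exp (- real (N k))"
        using q by (simp flip: exp_of_nat_mult)
      also have "R k ^ q = R k * R k ^ (q - 1)" using q by (simp flip: power_Suc)
      finally have prod: "(\<Prod>j\<in>{1..q}. R k * (exp (- (N k / q)) * (N k / q) ^ n k j / fact (n k j))) =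
          R k * R k ^ (q - 1) * (exp (- real (N k)) * (N k / q) ^ N k / (\<Prod>j\<in>{1..q}. fact (n k j)))" .
      have R_eq: "sqrt (N k) = R k" by (simp add: R_def)
      show ?case unfolding prod R_eq using Rk elim q by (simp add: power_divide)
    qed
  qed
qed

text \<open>Dividing the integral representation by the main term leaves
  \<open>\<kappa> * J / F\<close>. Both \<open>J\<close> and \<open>F\<close> decay on the scale
  \<open>1 / X\<close> with explicit constants, so the claim reduces to an identity between these
  constants.\<close>

theorem AO_complete_multipartite_asymptotics:
  fixes W :: "nat \<Rightarrow> nat \<Rightarrow> 'v set" and N :: "nat \<Rightarrow> nat"
  assumes q: "q \<ge> 2"
    and W: "\<And>k. disjoint_family_on (W k) {1..q}" "\<And>k j. j \<in> {1..q} \<Longrightarrow> finite (W k j)"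
    and N: "filterlim N at_top sequentially"
    and sum: "\<And>k. N k = (\<Sum>j\<in>{1..q}. card (W k j))"
    and B: "\<forall>\<^sub>F k in sequentially. \<forall>j\<in>{1..q}. \<bar>real (card (W k j)) - N k / q\<bar> \<le> B"
  shows "(\<lambda>k. real (AO (complete_multipartite q (W k)))) \<sim>[sequentially] (\<lambda>k. AO_main_term q (N k))"
proof -
  define L where "L = Lq q"
  define \<mu> where "\<mu> = L * exp (- L)"
  define v where "v = L * (1 - L) * exp (- L)"
  have L: "0 < L" "L < 1" "exp (- L) = (real q - 1) / real q"
    using Lq_bounds[OF q] by (auto simp: L_def)
  interpret lattice_exponent "part_exponent L" \<mu> v
    unfolding \<mu>_def v_def by (rule lattice_exponent_part[OF L(1,2)])
  have \<mu>: "\<mu> > 0" using L(1) by (simp add: \<mu>_def)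
  obtain C where C: "\<And>t m. t > 0 \<Longrightarrow> \<bar>real m - t * \<mu>\<bar> * norm (lattice_density (part_exponent L) t (real m)) \<le> C"
    using part_density_bound[OF L(1,2)] unfolding \<mu>_def by blast
  have N': "filterlim (\<lambda>k. real (N k)) at_top sequentially"
    by (rule filterlim_compose[OF filterlim_real_sequentially N])
  define X where "X = (\<lambda>k. sqrt (N k) ^ (q - 1))"
  define J where "J = (\<lambda>k. LINT t:{0<..}|lborel. \<Prod>j\<in>{1..q}. lattice_density (part_exponent L) t (real (card (W k j))))"
  define F where "F = (\<lambda>k. fact (N k) / (real q ^ N k * (\<Prod>j\<in>{1..q}. fact (card (W k j)))))"
  \<comment> \<open>Each Poisson weight has limiting height \<open>1 / a\<close>, each part density
    \<open>1 / (a * b)\<close>; \<open>\<kappa>\<close> collects the part of the main term's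
    denominator outside \<open>q ^ N * L ^ N\<close>.\<close>
  define b where "b = sqrt (1 - L)"
  define a where "a = sqrt (2 * pi / q)"
  define \<kappa> where "\<kappa> = (real q - 1) * b ^ (q - 1) * L"
  have ab: "a > 0" "b > 0" using L q by (auto simp: a_def b_def)
  have w: "v / (q * \<mu>) = (1 - L) / q" using L(1) by (simp add: v_def \<mu>_def)
  have "(\<lambda>k. of_real (X k) * J k) \<longlonglongrightarrow> complex_of_real ((1 / sqrt (2 * pi * ((1 - L) / q))) ^ q * (sqrt (2 * pi * ((1 - L) / q) / q) / \<mu>))"
    unfolding X_def J_def using diagonal_integral_asymptotics[OF \<mu> q C N' B] unfolding w .
  also have "2 * pi * ((1 - L) / q) = 2 * pi / q * (1 - L)" by simp
  also have "sqrt (2 * pi / q * (1 - L)) = a * b" unfolding a_def b_def by (rule real_sqrt_mult)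
  also have "sqrt (2 * pi / q * (1 - L) / q) = a * b / sqrt q" unfolding a_def b_def by (simp only: real_sqrt_mult real_sqrt_divide)
  finally have lim1: "(\<lambda>k. of_real (X k) * J k) \<longlonglongrightarrow> complex_of_real ((1 / (a * b)) ^ q * (a * b / sqrt q / \<mu>))" .
  have "(\<lambda>k. X k * F k) \<longlonglongrightarrow> (1 / a) ^ q * sqrt (2 * pi)"
    unfolding X_def F_def a_def using q by (intro fact_multinomial_asymptotics[OF _ N sum B]) simp
  also have "sqrt (2 * pi) = a * sqrt q" using q by (simp add: a_def flip: real_sqrt_mult)
  finally have lim2: "(\<lambda>k. complex_of_real (X k * F k)) \<longlonglongrightarrow> of_real ((1 / a) ^ q * (a * sqrt q))"
    by (rule tendsto_of_real)
  have "(\<lambda>k. of_real (X k) * J k * of_real \<kappa> / of_real (X k * F k)) \<longlonglongrightarrow>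
     of_real ((1 / (a * b)) ^ q * (a * b / sqrt q / \<mu>)) * of_real \<kappa> / of_real ((1 / a) ^ q * (a * sqrt q))"
    using ab q by (intro tendsto_divide tendsto_mult lim1 lim2 tendsto_const) simp
  also have "complex_of_real ((1 / (a * b)) ^ q * (a * b / sqrt q / \<mu>)) * of_real \<kappa> / of_real ((1 / a) ^ q * (a * sqrt q)) =
      of_real ((1 / (a * b)) ^ q * (a * b / sqrt q / \<mu>) * \<kappa> / ((1 / a) ^ q * (a * sqrt q)))"
    by simp
  also have "(1 / (a * b)) ^ q * (a * b / sqrt q / \<mu>) * \<kappa> / ((1 / a) ^ q * (a * sqrt q)) = 1"
  proof -
    have bq: "b ^ q = b * b ^ (q - 1)" using q by (simp flip: power_Suc)
    have \<mu>q: "\<mu> = L * (real q - 1) / q" by (simp add: \<mu>_def L(3))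
    have "(1 / (a * b)) ^ q * (a * b / sqrt q / \<mu>) * \<kappa> / ((1 / a) ^ q * (a * sqrt q)) =
        \<kappa> * b / (b ^ q * \<mu> * (sqrt q * sqrt q))"
      using ab \<mu> q by (simp add: power_divide power_mult_distrib field_simps)
    also have "\<dots> = 1" using ab L(1) q by (simp add: bq \<mu>q \<kappa>_def)
    finally show ?thesis .
  qed
  finally have lim: "(\<lambda>k. of_real (X k) * J k * of_real \<kappa> / of_real (X k * F k)) \<longlonglongrightarrow> complex_of_real 1" .
  have "eventually (\<lambda>k. N k > 0) sequentially"
    by (rule eventually_compose_filterlim[OF eventually_gt_at_top N])
  then have "eventually (\<lambda>k. of_real (X k) * J k * of_real \<kappa> / of_real (X k * F k) =
      complex_of_real (real (AO (complete_multipartite q (W k))) / AO_main_term q (N k))) sequentially"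
  proof eventually_elim
    case (elim k)
    then have X: "X k \<noteq> 0" by (simp add: X_def)
    define Pf :: real where "Pf = (\<Prod>j\<in>{1..q}. fact (card (W k j)))"
    have Pf: "Pf \<noteq> 0" by (simp add: Pf_def)
    have "(1 - L) powr ((real q - 1) / 2) = b ^ (q - 1)"
    proof -
      have "b ^ (q - 1) = b powr (real (q - 1))" using ab by (simp add: powr_realpow)
      also have "\<dots> = (1 - L) powr (1 / 2 * real (q - 1))"
        using L by (simp add: b_def powr_half_sqrt[symmetric] powr_powr)
      finally show ?thesis using q by (simp add: of_nat_diff)
    qed
    then have main: "AO_main_term q (N k) = fact (N k) / (\<kappa> * real q ^ N k * L ^ N k)"
      by (simp add: AO_main_term_def \<kappa>_def L_def[symmetric] mult_ac)
    have AO: "complex_of_real (real (AO (complete_multipartite q (W k)))) = of_real (Pf / L ^ N k) * J k"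
      using AO_complete_multipartite_integral[OF q W, of k] by (simp add: Pf_def L_def J_def sum)
    have "of_real (X k) * J k * of_real \<kappa> / of_real (X k * F k) = J k * of_real (\<kappa> / F k)"
      using X by simp
    also have "\<kappa> / F k = (Pf / L ^ N k) / (fact (N k) / (\<kappa> * real q ^ N k * L ^ N k))"
      using L(1) unfolding F_def Pf_def[symmetric] by simp
    finally show ?case unfolding main of_real_divide[of "real _"] AO
      by (simp only: of_real_divide of_real_mult times_divide_eq_right times_divide_eq_left mult.commute)
  qed
  then have "(\<lambda>k. complex_of_real (real (AO (complete_multipartite q (W k))) / AO_main_term q (N k))) \<longlonglongrightarrow> complex_of_real 1"
    by (rule Lim_transform_eventually[OF lim])
  then have "(\<lambda>k. real (AO (complete_multipartite q (W k))) / AO_main_term q (N k)) \<longlonglongrightarrow> 1"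
    unfolding tendsto_of_real_iff .
  then show ?thesis by (rule asymp_equivI')
qed

theorem theorem2:
  fixes q a :: nat and V :: "nat \<Rightarrow> 'v set" and H :: "'v sgraph"
  assumes "q \<ge> 2" and "a \<ge> 1"
    and "disjoint_family_on V {1..q}"
    and "\<And>j. j \<in> {1..q} \<Longrightarrow> card (V j) = a"
    and "H = complete_multipartite q V"
  shows
    "((\<lambda>M. real (AO (blowup H (\<lambda>_. M)))) \<sim>[sequentially] (\<lambda>M. AO_main_term q (a * q * M))) \<and>
     (\<forall>(sz :: nat \<Rightarrow> 'v \<Rightarrow> nat) (N :: nat \<Rightarrow> nat).
        (\<forall>n. N n = (\<Sum>i\<in>verts H. sz n i)) \<longrightarrow>
        filterlim N at_top sequentially \<longrightarrow>
        (\<forall>j\<in>{1..q}. (\<lambda>n. real (\<Sum>i\<in>V j. sz n i) - real (N n) / real q) \<in> O(\<lambda>_. 1)) \<longrightarrow>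
        (\<lambda>n. real (AO (blowup H (sz n)))) \<sim>[sequentially] (\<lambda>n. AO_main_term q (N n)))"
proof -
  \<comment> \<open>An infinite set has cardinality 0, so \<open>a \<ge> 1\<close> forces the
    classes to be finite.\<close>
  have finV: "finite (V j)" if "j \<in> {1..q}" for j
    using assms(2) assms(4)[OF that] by (intro card_ge_0_finite) simp
  have verts: "verts H = (\<Union>j\<in>{1..q}. V j)"
    by (simp add: assms(5) verts_def complete_multipartite_def)
  have sum_verts: "(\<Sum>i\<in>verts H. f i) = (\<Sum>j\<in>{1..q}. \<Sum>i\<in>V j. f i)" for f :: "'v \<Rightarrow> nat"
    unfolding verts using finV assms(3)
    by (intro sum.UNION_disjoint) (simp_all add: disjoint_family_on_def)
  have general: "(\<lambda>n. real (AO (blowup H (sz n)))) \<sim>[sequentially] (\<lambda>n. AO_main_term q (N n))"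
    if N: "\<And>n. N n = (\<Sum>i\<in>verts H. sz n i)" "filterlim N at_top sequentially"
      and O: "\<And>j. j \<in> {1..q} \<Longrightarrow> (\<lambda>n. real (\<Sum>i\<in>V j. sz n i) - real (N n) / real q) \<in> O(\<lambda>_. 1)"
    for sz :: "nat \<Rightarrow> 'v \<Rightarrow> nat" and N
  proof -
    define W where "W = (\<lambda>n j. SIGMA i:V j. {..<sz n i})"
    have card: "card (W n j) = (\<Sum>i\<in>V j. sz n i)" if "j \<in> {1..q}" for n j
      using finV[OF that] by (simp add: W_def)
    have "\<exists>c. \<forall>\<^sub>F n in sequentially. \<bar>real (card (W n j)) - real (N n) / real q\<bar> \<le> c" if "j \<in> {1..q}" for j
      using O[OF that] card[OF that] by (auto elim!: landau_o.bigE)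
    \<comment> \<open>Each class comes with its own bound; their maximum serves all classes at
      once.\<close>
    then obtain c where c: "\<And>j. j \<in> {1..q} \<Longrightarrow>
        \<forall>\<^sub>F n in sequentially. \<bar>real (card (W n j)) - real (N n) / real q\<bar> \<le> c j" by metis
    have B: "\<forall>\<^sub>F n in sequentially. \<forall>j\<in>{1..q}. \<bar>real (card (W n j)) - real (N n) / real q\<bar> \<le> Max (c ` {1..q})"
    proof (intro eventually_ball_finite ballI)
      fix j assume j: "j \<in> {1..q}"
      then have "c j \<le> Max (c ` {1..q})" by (intro Max_ge) auto
      then show "\<forall>\<^sub>F n in sequentially. \<bar>real (card (W n j)) - real (N n) / real q\<bar> \<le> Max (c ` {1..q})"
        using c[OF j] by (auto elim: eventually_mono)
    qed simp
    have "(\<lambda>n. real (AO (complete_multipartite q (W n)))) \<sim>[sequentially] (\<lambda>n. AO_main_term q (N n))"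
    proof (rule AO_complete_multipartite_asymptotics[OF assms(1) _ _ N(2) _ B])
      show "disjoint_family_on (W n) {1..q}" for n
        using assms(3) by (fastforce simp: disjoint_family_on_def W_def)
      show "finite (W n j)" if "j \<in> {1..q}" for n j using finV[OF that] by (simp add: W_def)
      show "N n = (\<Sum>j\<in>{1..q}. card (W n j))" for n unfolding N(1) sum_verts by (simp add: card)
    qed
    moreover have "AO (blowup H (sz n)) = AO (complete_multipartite q (W n))" for n
      unfolding assms(5) W_def by (rule AO_cong_edges[OF edges_blowup_complete_multipartite])
    ultimately show ?thesis by simp
  qed
  \<comment> \<open>With equal sizes every class has total exactly \<open>a * M = N / q\<close>, so
    the deviation is zero.\<close>
  have "(\<lambda>M. real (AO (blowup H (\<lambda>_. M)))) \<sim>[sequentially] (\<lambda>M. AO_main_term q (a * q * M))"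
  proof (rule general)
    show "a * q * M = (\<Sum>i\<in>verts H. M)" for M unfolding sum_verts by (simp add: assms(4))
    show "filterlim (\<lambda>M. a * q * M) at_top sequentially"
      using assms(1,2) by (intro mult_nat_left_at_top) simp
    show "(\<lambda>M. real (\<Sum>i\<in>V j. M) - real (a * q * M) / real q) \<in> O(\<lambda>_. 1)" if "j \<in> {1..q}" for j
      using assms(1) assms(4)[OF that] by simp
  qed
  then show ?thesis using general by blast
qed

end
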